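(* Let $\Delta$ be a forest of dimension $1$ (all of whose facets are edges) with vertices $x_1,\dots,x_n$, and let $I\subset R=K[x_1,\dots,x_n]$ be its facet ideal. Then, as a $K$-algebra, the Koszul homology $H_\bullet(R/I)$ is generated by the homology classes of linear monomial cycles.
   Context: $K$ is a field. A $1$-dimensional forest (all of whose facets are edges) is a finite simple graph without cycles and without isolated vertices; its facets are its edges. The vertices are identified with the variables of $R=K[x_1,\dots,x_n]$, and the facet ideal (edge ideal) $I$ is generated by the monomials $x_ix_j$ with $\{x_i,x_j\}$ an edge. $K_\bullet(R/I)$ is the Koszul complex of $R/I$ with respect to $x_1,\dots,x_n$, with exterior basis elements $e_1,\dots,e_n$ and $d(e_i)=x_i$; $H_\bullet(R/I)$ is its homology, a graded $K$-algebra with multiplication induced by $\wedge$. For a monomial ideal $I$, a cycle of $K_\bullet(R/I)$ is a monomial cycle if it is of the form $fe_L$ with $f$ a monomial and $e_L=e_{i_1}\wedge\cdots\wedge e_{i_r}$ for $L=\{i_1<\dots<i_r\}\subseteq\{1,\dots,n\}$. If $d$ is the least degree of the generators of $I$, a monomial cycle $fe_L$ is called linear if $f$ is a monomial of degree $d-1$ (here $d=2$, so $f$ is a variable). *)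

theory Defs
  imports
    "HOL-Library.Poly_Mapping"
    "HOL-Algebra.Generated_Rings"
    "HOL-Algebra.QuotRing"
    "HOL-Algebra.Algebraic_Closure_Type"
begin

text \<open>
  The Koszul algebra \<open>K(x; A)\<close> of a commutative ring \<open>A\<close> with respect to a family \<open>x\<close> of
  elements indexed by a finite linearly ordered type. A chain \<open>f\<close> stands for
  \<open>\<Sum>\<^sub>L f(L) e\<^sub>L\<close>, where \<open>e\<^sub>L\<close> is the wedge product of the \<open>e\<^sub>i\<close>, \<open>i \<in> L\<close>, in increasing order.
  For disjoint \<open>S\<close>, \<open>T\<close> the product of \<open>e\<^sub>S\<close> and \<open>e\<^sub>T\<close> is \<open>(-1)^inv(S,T) e\<^bsub>S \<union> T\<^esub>\<close> with
  \<open>inv(S,T)\<close> the number of pairs \<open>i \<in> S\<close>, \<open>j \<in> T\<close> with \<open>j < i\<close>; it vanishes if \<open>S\<close> and \<open>T\<close> meet.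
\<close>

definition koszul_sign :: "('a, 'b) ring_scheme \<Rightarrow> nat \<Rightarrow> 'a" where
  "koszul_sign A k = (\<ominus>\<^bsub>A\<^esub> \<one>\<^bsub>A\<^esub>) [^]\<^bsub>A\<^esub> k"

definition koszul_wedge ::
  "('a, 'b) ring_scheme \<Rightarrow> ('i::{finite,linorder} set \<Rightarrow> 'a) \<Rightarrow> ('i set \<Rightarrow> 'a) \<Rightarrow> ('i set \<Rightarrow> 'a)" where
  "koszul_wedge A f g = (\<lambda>L. \<Oplus>\<^bsub>A\<^esub>S \<in> Pow L.
     koszul_sign A (card {(i, j). i \<in> S \<and> j \<in> L - S \<and> j < i}) \<otimes>\<^bsub>A\<^esub> (f S \<otimes>\<^bsub>A\<^esub> g (L - S)))"

definition koszul_term :: "('a, 'b) ring_scheme \<Rightarrow> 'a \<Rightarrow> 'i set \<Rightarrow> ('i set \<Rightarrow> 'a)" where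
  "koszul_term A a L = (\<lambda>S. if S = L then a else \<zero>\<^bsub>A\<^esub>)"

definition koszul_algebra :: "('a, 'b) ring_scheme \<Rightarrow> ('i::{finite,linorder} set \<Rightarrow> 'a) ring" where
  "koszul_algebra A = \<lparr>
     carrier = {f. \<forall>L. f L \<in> carrier A},
     monoid.mult = koszul_wedge A,
     one = koszul_term A \<one>\<^bsub>A\<^esub> {},
     ring.zero = (\<lambda>L. \<zero>\<^bsub>A\<^esub>),
     add = (\<lambda>f g L. f L \<oplus>\<^bsub>A\<^esub> g L)\<rparr>"

text \<open>
  The differential is determined by
  \<open>d(e\<^sub>L) = \<Sum>\<^sub>k (-1)^(k-1) x(i\<^sub>k) e\<^bsub>L - {i\<^sub>k}\<^esub>\<close> for \<open>L = {i\<^sub>1 < \<dots> < i\<^sub>r}\<close>, so \<open>e\<^sub>L\<close> receives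
  a contribution from each \<open>e\<^bsub>L \<union> {i}\<^esub>\<close> with \<open>i \<notin> L\<close>.
\<close>

definition koszul_diff ::
  "('a, 'b) ring_scheme \<Rightarrow> ('i::{finite,linorder} \<Rightarrow> 'a) \<Rightarrow> ('i set \<Rightarrow> 'a) \<Rightarrow> ('i set \<Rightarrow> 'a)" where
  "koszul_diff A x f = (\<lambda>L. \<Oplus>\<^bsub>A\<^esub>i \<in> - L.
     koszul_sign A (card {j \<in> L. j < i}) \<otimes>\<^bsub>A\<^esub> (x i \<otimes>\<^bsub>A\<^esub> f (insert i L)))"

definition koszul_cycles ::
  "('a, 'b) ring_scheme \<Rightarrow> ('i::{finite,linorder} \<Rightarrow> 'a) \<Rightarrow> ('i set \<Rightarrow> 'a) set" where
  "koszul_cycles A x =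
     {f \<in> carrier (koszul_algebra A). koszul_diff A x f = \<zero>\<^bsub>koszul_algebra A\<^esub>}"

definition koszul_boundaries ::
  "('a, 'b) ring_scheme \<Rightarrow> ('i::{finite,linorder} \<Rightarrow> 'a) \<Rightarrow> ('i set \<Rightarrow> 'a) set" where
  "koszul_boundaries A x = koszul_diff A x ` carrier (koszul_algebra A)"

definition koszul_cycle_ring ::
  "('a, 'b) ring_scheme \<Rightarrow> ('i::{finite,linorder} \<Rightarrow> 'a) \<Rightarrow> ('i set \<Rightarrow> 'a) ring" where
  "koszul_cycle_ring A x = (koszul_algebra A)\<lparr>carrier := koszul_cycles A x\<rparr>"

text \<open>The total homology, i.e. the direct sum of all \<open>H\<^sub>r\<close>, as a ring.\<close>

definition koszul_homology ::
  "('a, 'b) ring_scheme \<Rightarrow> ('i::{finite,linorder} \<Rightarrow> 'a) \<Rightarrow> ('i set \<Rightarrow> 'a) set ring" where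
  "koszul_homology A x = koszul_cycle_ring A x Quot koszul_boundaries A x"

definition koszul_class ::
  "('a, 'b) ring_scheme \<Rightarrow> ('i::{finite,linorder} \<Rightarrow> 'a) \<Rightarrow> ('i set \<Rightarrow> 'a) \<Rightarrow> ('i set \<Rightarrow> 'a) set" where
  "koszul_class A x z = koszul_boundaries A x +>\<^bsub>koszul_cycle_ring A x\<^esub> z"


text \<open>
  Polynomials over \<open>'k\<close> in the variables indexed by \<open>'n\<close> are finitely supported functions on
  exponent vectors.
\<close>

type_synonym 'n expo = "'n \<Rightarrow>\<^sub>0 nat"
type_synonym ('n, 'k) mpoly = "'n expo \<Rightarrow>\<^sub>0 'k"

abbreviation poly_ring :: "('n, 'k::field) mpoly ring" where
  "poly_ring \<equiv> ring_of_type_algebra"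

definition monomial :: "'n expo \<Rightarrow> ('n, 'k::field) mpoly" where
  "monomial u = Poly_Mapping.single u 1"

definition var :: "'n \<Rightarrow> ('n, 'k::field) mpoly" where
  "var i = monomial (Poly_Mapping.single i 1)"

definition const :: "'k \<Rightarrow> ('n, 'k::field) mpoly" where
  "const c = Poly_Mapping.single 0 c"

definition expo_degree :: "'n::finite expo \<Rightarrow> nat" where
  "expo_degree u = (\<Sum>i\<in>UNIV. Poly_Mapping.lookup u i)"

definition monomial_ideal :: "'n expo set \<Rightarrow> ('n, 'k::field) mpoly set" where
  "monomial_ideal G = genideal poly_ring (monomial ` G)"

abbreviation residue :: "('n, 'k::field) mpoly set \<Rightarrow> ('n, 'k) mpoly \<Rightarrow> ('n, 'k) mpoly set" where
  "residue I p \<equiv> I +>\<^bsub>poly_ring\<^esub> p"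

abbreviation residue_var :: "('n, 'k::field) mpoly set \<Rightarrow> 'n \<Rightarrow> ('n, 'k) mpoly set" where
  "residue_var I i \<equiv> residue I (var i)"

text \<open>\<open>H(R/I)\<close> for \<open>R = K[x\<^sub>i | i :: 'n]\<close>, with respect to the residues of all the variables.\<close>

definition quot_homology ::
  "('n::{finite,linorder}, 'k::field) mpoly set \<Rightarrow> ('n set \<Rightarrow> ('n, 'k) mpoly set) set ring" where
  "quot_homology I = koszul_homology (poly_ring Quot I) (residue_var I)"

definition quot_class ::
  "('n::{finite,linorder}, 'k::field) mpoly set \<Rightarrow> ('n set \<Rightarrow> ('n, 'k) mpoly set)
     \<Rightarrow> ('n set \<Rightarrow> ('n, 'k) mpoly set) set" where
  "quot_class I z = koszul_class (poly_ring Quot I) (residue_var I) z"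

definition is_monomial_cycle ::
  "('n::{finite,linorder}, 'k::field) mpoly set \<Rightarrow> 'n expo \<Rightarrow> 'n set \<Rightarrow> bool" where
  "is_monomial_cycle I u L \<longleftrightarrow>
     koszul_term (poly_ring Quot I) (residue I (monomial u)) L
       \<in> koszul_cycles (poly_ring Quot I) (residue_var I)"

text \<open>
  For the ideal generated by the monomials with exponent vectors in \<open>G\<close>: the monomial cycles
  \<open>f e\<^sub>L\<close> with \<open>deg f = d - 1\<close>, where \<open>d\<close> is the least degree of a generator.
\<close>

definition linear_monomial_cycles ::
  "'n::{finite,linorder} expo set \<Rightarrow> ('n set \<Rightarrow> ('n, 'k::field) mpoly set) set" where
  "linear_monomial_cycles G =
     {koszul_term (poly_ring Quot monomial_ideal G) (residue (monomial_ideal G) (monomial u)) L | u L.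
        is_monomial_cycle (monomial_ideal G :: ('n, 'k) mpoly set) u L
        \<and> Suc (expo_degree u) = (LEAST d. \<exists>g\<in>G. expo_degree g = d)}"

text \<open>The image of \<open>K\<close> in the homology algebra.\<close>

definition scalar_classes ::
  "('n::{finite,linorder}, 'k::field) mpoly set \<Rightarrow> ('n set \<Rightarrow> ('n, 'k) mpoly set) set set" where
  "scalar_classes I =
     range (\<lambda>c. quot_class I (koszul_term (poly_ring Quot I) (residue I (const c)) {}))"

text \<open>
  The \<open>K\<close>-subalgebra generated by \<open>S\<close> is the subring generated by \<open>S\<close> together with the
  image of \<open>K\<close>.
\<close>

definition generated_subalgebra ::
  "('n::{finite,linorder}, 'k::field) mpoly set \<Rightarrow> ('n set \<Rightarrow> ('n, 'k) mpoly set) set set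
     \<Rightarrow> ('n set \<Rightarrow> ('n, 'k) mpoly set) set set" where
  "generated_subalgebra I S = generate_ring (quot_homology I) (scalar_classes I \<union> S)"


text \<open>
  Graphs on the whole vertex type are given by their edge sets. The list of vertices of a cycle
  does not repeat the initial vertex at the end.
\<close>

definition simple_graph :: "'v set set \<Rightarrow> bool" where
  "simple_graph E \<longleftrightarrow> (\<forall>e\<in>E. card e = 2)"

definition graph_cycle :: "'v set set \<Rightarrow> 'v list \<Rightarrow> bool" where
  "graph_cycle E vs \<longleftrightarrow> 3 \<le> length vs \<and> distinct vs \<and>
     (\<forall>k<length vs. {vs ! k, vs ! (Suc k mod length vs)} \<in> E)"

text \<open>A simplicial forest all of whose facets are edges; no vertex is isolated.\<close>

definition edge_forest :: "'v::finite set set \<Rightarrow> bool" where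
  "edge_forest E \<longleftrightarrow> simple_graph E \<and> (\<nexists>vs. graph_cycle E vs) \<and> (\<forall>v. \<exists>e\<in>E. v \<in> e)"

definition facet_expo :: "'n set \<Rightarrow> 'n expo" where
  "facet_expo F = (\<Sum>i\<in>F. Poly_Mapping.single i 1)"

definition facet_generators :: "'n set set \<Rightarrow> 'n expo set" where
  "facet_generators \<F> = facet_expo ` \<F>"

definition facet_ideal :: "'n set set \<Rightarrow> ('n, 'k::field) mpoly set" where
  "facet_ideal \<F> = monomial_ideal (facet_generators \<F>)"

end

theory Submission
  imports Defs
begin

text \<open>
  The Koszul complex of \<open>R/I\<close> is multigraded. In multidegree \<open>a\<close> it has the basis
  \<open>x\<^bsup>a - L\<^esup> e\<^sub>L\<close>, where \<open>L\<close> is contained in the support of \<open>a\<close> and \<open>x\<^bsup>a - L\<^esup>\<close> is not in \<open>I\<close>. Argue by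
  induction on the total degree of \<open>a\<close>. For \<open>a \<noteq> 0\<close> choose a vertex \<open>v\<close> of the support with at most
  one neighbour there. Exterior multiplication by \<open>e\<^sub>v / x\<^sub>v\<close> is a contracting homotopy of the
  multigraded piece of the Koszul complex of \<open>R\<close>; modulo \<open>I\<close> it makes a cycle homologous to one
  whose terms \<open>x\<^bsup>a - L\<^esup> e\<^sub>L\<close> all satisfy \<open>v \<in> L\<close> and \<open>x\<^sub>v x\<^bsup>a - L\<^esup> \<in> I\<close>. Unless that
  cycle vanishes, \<open>v\<close> has a unique neighbour \<open>w\<close> in the support and \<open>x\<^sub>w\<close> divides every
  \<open>x\<^bsup>a - L\<^esup>\<close>. Therefore the neighbours \<open>M\<close> of \<open>w\<close> in the support
  occur in \<open>L\<close> and not in \<open>x\<^bsup>a - L\<^esup>\<close>, so the cycle is the product of the linear monomial cycle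
  \<open>x\<^sub>w e\<^sub>M\<close> and a chain of smaller multidegree, whose support contains no neighbour of \<open>w\<close>. That
  chain is again a cycle, since multiplication by \<open>x\<^sub>w\<close> is injective modulo \<open>I\<close> on such monomials.
\<close>

subsection \<open>The Koszul algebra of a type-class ring\<close>

text \<open>A double sum of indicators instead of the cardinality occurring in
  \<open>koszul_wedge\<close>: additivity in either argument then comes from additivity of
  sums.\<close>

definition invs :: "'i::{finite,linorder} set \<Rightarrow> 'i set \<Rightarrow> nat" where
  "invs S T = (\<Sum>i\<in>S. \<Sum>j\<in>T. of_bool (j < i))"

lemma invs_eq_card: "invs S T = card {(i, j). i \<in> S \<and> j \<in> T \<and> j < i}"
proof -
  have "invs S T = (\<Sum>p\<in>S \<times> T. of_bool (snd p < fst p))"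
    unfolding invs_def by (simp add: sum.cartesian_product case_prod_unfold del: sum_of_bool_eq)
  also have "\<dots> = card (S \<times> T \<inter> {p. snd p < fst p})" by simp
  also have "S \<times> T \<inter> {p. snd p < fst p} = {(i, j). i \<in> S \<and> j \<in> T \<and> j < i}" by auto
  finally show ?thesis .
qed

lemma invs_singleton_eq_card: "invs {i} T = card {j \<in> T. j < i}"
proof -
  have "T \<inter> {j. j < i} = {j \<in> T. j < i}" by auto
  then show ?thesis by (simp add: invs_def)
qed

lemma invs_empty [simp]: "invs {} T = 0" "invs S {} = 0"
  by (simp_all add: invs_def)

lemma invs_insert_left: "i \<notin> S \<Longrightarrow> invs (insert i S) T = invs {i} T + invs S T"
  by (simp add: invs_def)

lemma invs_insert_right: "i \<notin> T \<Longrightarrow> invs S (insert i T) = invs S {i} + invs S T"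
  by (simp add: invs_def sum.distrib del: sum_of_bool_eq)

lemma invs_Un_left: "S \<inter> S' = {} \<Longrightarrow> invs (S \<union> S') T = invs S T + invs S' T"
  by (simp add: invs_def sum.union_disjoint)

lemma invs_Un_right: "T \<inter> T' = {} \<Longrightarrow> invs S (T \<union> T') = invs S T + invs S T'"
  by (simp add: invs_def sum.union_disjoint sum.distrib del: sum_of_bool_eq)

text \<open>Each element of S lies on exactly one side of i. This is where the sign
  \<open>(-1) ^ card S\<close> of the Leibniz rule comes from.\<close>

lemma invs_commute: "i \<notin> S \<Longrightarrow> invs {i} S + invs S {i} = card S"
proof -
  assume "i \<notin> S"
  then have "(\<Sum>j\<in>S. of_bool (j < i) + of_bool (i < j)) = (\<Sum>j\<in>S. 1 :: nat)"
    by (intro sum.cong) (auto dest: not_less_iff_gr_or_eq[THEN iffD1])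
  then show ?thesis by (simp add: invs_def sum.distrib del: sum_of_bool_eq)
qed

section \<open>Exterior product and differential of chains\<close>

definition kwedge ::
  "('i::{finite,linorder} set \<Rightarrow> 'a::comm_ring_1) \<Rightarrow> ('i set \<Rightarrow> 'a) \<Rightarrow> ('i set \<Rightarrow> 'a)" where
  "kwedge f g = (\<lambda>L. \<Sum>S\<in>Pow L. (-1) ^ invs S (L - S) * (f S * g (L - S)))"

definition kdiff :: "('i::{finite,linorder} \<Rightarrow> 'a::comm_ring_1) \<Rightarrow> ('i set \<Rightarrow> 'a) \<Rightarrow> ('i set \<Rightarrow> 'a)" where
  "kdiff x f = (\<lambda>L. \<Sum>i\<in>- L. (-1) ^ invs {i} L * (x i * f (insert i L)))"

definition kterm :: "'i set \<Rightarrow> 'a::zero \<Rightarrow> 'i set \<Rightarrow> 'a" where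
  "kterm L a = (\<lambda>S. if S = L then a else 0)"

text \<open>Both sides sum over the ordered partitions of L into three blocks; with U the union of
  the first two, the exponents agree because \<open>invs\<close> is additive, each being the sum
  over the three pairs of blocks.\<close>

lemma kwedge_assoc: "kwedge (kwedge f g) h = kwedge f (kwedge g h)"
proof
  fix L
  have "kwedge (kwedge f g) h L =
    (\<Sum>U\<in>Pow L. \<Sum>S\<in>Pow U. (-1) ^ (invs U (L - U) + invs S (U - S)) * (f S * g (U - S) * h (L - U)))"
    unfolding kwedge_def by (simp add: sum_distrib_left sum_distrib_right power_add ac_simps)
  also have "\<dots> = (\<Sum>(U, S)\<in>Sigma (Pow L) Pow.
      (-1) ^ (invs U (L - U) + invs S (U - S)) * (f S * g (U - S) * h (L - U)))"
    by (subst sum.Sigma) auto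
  also have "\<dots> = (\<Sum>(S, T)\<in>Sigma (Pow L) (\<lambda>S. Pow (L - S)).
      (-1) ^ (invs S (L - S) + invs T (L - S - T)) * (f S * g T * h (L - S - T)))"
  proof (rule sum.reindex_bij_witness[where i = "\<lambda>(S, T). (S \<union> T, S)" and j = "\<lambda>(U, S). (S, U - S)"];
      clarsimp)
    fix U S assume "U \<subseteq> L" "S \<subseteq> U"
    then have "U = S \<union> (U - S)" "L - S = (U - S) \<union> (L - U)" "L - S - (U - S) = L - U" by auto
    then have "invs U (L - U) = invs S (L - U) + invs (U - S) (L - U)"
      "invs S (L - S) = invs S (U - S) + invs S (L - U)" "L - S - (U - S) = L - U"
      using invs_Un_left[of S "U - S" "L - U"] invs_Un_right[of "U - S" "L - U" S] by auto
    then show "(- 1) ^ (invs S (L - S) + invs (U - S) (L - S - (U - S))) * (f S * g (U - S) * h (L - S - (U - S)))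
      = (- 1) ^ (invs U (L - U) + invs S (U - S)) * (f S * g (U - S) * h (L - U))"
      by (simp add: ac_simps)
  qed auto
  also have "\<dots> = (\<Sum>S\<in>Pow L. \<Sum>T\<in>Pow (L - S).
      (-1) ^ (invs S (L - S) + invs T (L - S - T)) * (f S * g T * h (L - S - T)))"
    by (subst sum.Sigma) auto
  also have "\<dots> = kwedge f (kwedge g h) L"
    unfolding kwedge_def by (simp add: sum_distrib_left sum_distrib_right power_add ac_simps)
  finally show "kwedge (kwedge f g) h L = kwedge f (kwedge g h) L" .
qed

lemma kwedge_term_left:
  "kwedge (kterm M a) g L = (if M \<subseteq> L then (-1) ^ invs M (L - M) * (a * g (L - M)) else 0)"
proof -
  have "kwedge (kterm M a) g L
      = (\<Sum>S\<in>Pow L. if S = M then (-1) ^ invs M (L - M) * (a * g (L - M)) else 0)"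
    unfolding kwedge_def kterm_def by (intro sum.cong) auto
  then show ?thesis by simp
qed

lemma kwedge_one_left: "kwedge (kterm {} 1) g = g"
  by (rule ext) (simp add: kwedge_term_left)

lemma kwedge_one_right: "kwedge g (kterm {} 1) = g"
proof
  fix L
  have "kwedge g (kterm {} 1) L = (\<Sum>S\<in>Pow L. if S = L then g L else 0)"
    unfolding kwedge_def kterm_def by (intro sum.cong) auto
  then show "kwedge g (kterm {} 1) L = g L" by simp
qed

lemma kwedge_add_left: "kwedge (\<lambda>L. f L + f' L) g = (\<lambda>L. kwedge f g L + kwedge f' g L)"
  by (simp add: kwedge_def algebra_simps sum.distrib)

lemma kwedge_add_right: "kwedge f (\<lambda>L. g L + g' L) = (\<lambda>L. kwedge f g L + kwedge f g' L)"
  by (simp add: kwedge_def algebra_simps sum.distrib)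

lemma kdiff_add: "kdiff x (\<lambda>L. f L + g L) = (\<lambda>L. kdiff x f L + kdiff x g L)"
  by (simp add: kdiff_def algebra_simps sum.distrib)

lemma kdiff_uminus: "kdiff x (\<lambda>L. - f L) = (\<lambda>L. - kdiff x f L)"
  by (simp add: kdiff_def sum_negf)

text \<open>A double sum over ordered pairs of distinct indices outside L, in which exchanging the
  two indices changes the sign.\<close>

lemma kdiff_kdiff: "kdiff x (kdiff x f) = (\<lambda>L. 0)"
proof
  fix L :: "'a set"
  define t where "t i j = (-1) ^ (invs {i} L + invs {j} (insert i L)) * (x i * x j * f (insert j (insert i L)))"
    for i j
  \<comment> \<open>The exponents of \<open>t i j\<close> and \<open>t j i\<close> share
    \<open>invs {i} L + invs {j} L\<close>; exactly one of them gains 1, according to the order of i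
    and j.\<close>
  have t: "t j i = - t i j" if "i \<in> - L" "j \<in> - L" "i \<noteq> j" for i j
    using that by (auto simp: t_def invs_insert_right insert_commute power_add invs_def neq_iff ac_simps)
  let ?P = "{p \<in> (- L) \<times> (- L). fst p < snd p}" and ?Q = "{p \<in> (- L) \<times> (- L). snd p < fst p}"
  have "kdiff x (kdiff x f) L = (\<Sum>i\<in>- L. \<Sum>j\<in>- insert i L. t i j)"
    by (simp add: kdiff_def t_def sum_distrib_left power_add ac_simps)
  also have "\<dots> = (\<Sum>p\<in>Sigma (- L) (\<lambda>i. - insert i L). t (fst p) (snd p))"
    by (simp add: sum.Sigma case_prod_beta)
  also have "Sigma (- L) (\<lambda>i. - insert i L) = ?P \<union> ?Q"
    by (auto simp: neq_iff)
  also have "(\<Sum>p\<in>?P \<union> ?Q. t (fst p) (snd p)) = (\<Sum>p\<in>?P. t (fst p) (snd p)) + (\<Sum>p\<in>?Q. t (fst p) (snd p))"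
    by (intro sum.union_disjoint) auto
  also have "(\<Sum>p\<in>?Q. t (fst p) (snd p)) = (\<Sum>p\<in>?P. - t (fst p) (snd p))"
    by (rule sum.reindex_bij_witness[where i = prod.swap and j = prod.swap])
      (auto, metis ComplI minus_minus neq_iff t)
  finally show "kdiff x (kdiff x f) L = 0" by (simp add: sum_negf)
qed

text \<open>The grading involution. It lets the Leibniz rule be stated for chains that are not
  homogeneous.\<close>

definition grade_inv :: "('i set \<Rightarrow> 'a::comm_ring_1) \<Rightarrow> 'i set \<Rightarrow> 'a" where
  "grade_inv f = (\<lambda>S. (-1) ^ card S * f S)"

lemma kdiff_grade_inv: "kdiff x (grade_inv f) = (\<lambda>L. - grade_inv (kdiff x f) L)"
  unfolding kdiff_def grade_inv_def
  by (simp add: sum_distrib_left sum_negf[symmetric] ac_simps)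

text \<open>Compare coefficients of e_L. An index i struck by d is either outside L and comes from
  the left or the right factor (\<open>A\<close> and \<open>B\<close>), or it lies in L
  (\<open>C\<close> and \<open>D\<close>). The latter terms arise only on the right-hand side, from
  products whose two factors both contain i, and they cancel.\<close>

lemma kdiff_kwedge:
  "kdiff x (kwedge f g) = (\<lambda>L. kwedge (kdiff x f) g L + kwedge (grade_inv f) (kdiff x g) L)"
proof
  fix L :: "'a set"
  define A where "A = (\<Sum>(i,S)\<in>(- L) \<times> Pow L. (-1) ^ (invs S (L - S) + invs {i} S) * (x i * f (insert i S) * g (L - S)))"
  define B where "B = (\<Sum>(i,S)\<in>(- L) \<times> Pow L. (-1) ^ (invs S (L - S) + card S + invs {i} (L - S)) * (x i * f S * g (insert i (L - S))))"
  define C where "C = (\<Sum>(S,i)\<in>Sigma (Pow L) (\<lambda>S. L - S). (-1) ^ (invs S (L - S) + invs {i} S) * (x i * f (insert i S) * g (L - S)))"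
  define D where "D = (\<Sum>(S,i)\<in>Sigma (Pow L) (\<lambda>S. S). (-1) ^ (invs S (L - S) + card S + invs {i} (L - S)) * (x i * f S * g (insert i (L - S))))"
  have l: "kdiff x (kwedge f g) L = A + B"
  proof -
    have *: "(-1) ^ invs {i} L * (x i * kwedge f g (insert i L))
      = (\<Sum>S\<in>Pow L. (-1) ^ (invs S (L - S) + invs {i} S) * (x i * f (insert i S) * g (L - S)))
      + (\<Sum>S\<in>Pow L. (-1) ^ (invs S (L - S) + card S + invs {i} (L - S)) * (x i * f S * g (insert i (L - S))))"
      if "i \<in> - L" for i
    proof -
      let ?t = "\<lambda>S. (-1) ^ (invs {i} L + invs S (insert i L - S)) * (x i * f S * g (insert i L - S))"
      have iL: "invs {i} L = invs {i} S + invs {i} (L - S)" if "S \<subseteq> L" for S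
        using that by (metis Diff_disjoint Diff_partition invs_Un_right)
      have "(-1) ^ invs {i} L * (x i * kwedge f g (insert i L)) = (\<Sum>S\<in>Pow (insert i L). ?t S)"
        by (simp add: kwedge_def sum_distrib_left power_add ac_simps)
      also have "\<dots> = (\<Sum>S\<in>Pow L. ?t S) + (\<Sum>S\<in>insert i ` Pow L. ?t S)"
        unfolding Pow_insert using that by (intro sum.union_disjoint) auto
      also have "(\<Sum>S\<in>insert i ` Pow L. ?t S) = (\<Sum>S\<in>Pow L. ?t (insert i S))"
        using that by (subst sum.reindex) (auto simp: inj_on_def)
      also have "\<dots> = (\<Sum>S\<in>Pow L. (-1) ^ (invs S (L - S) + invs {i} S) * (x i * f (insert i S) * g (L - S)))"
      proof (intro sum.cong refl)
        fix S assume S: "S \<in> Pow L"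
        with that have "insert i L - insert i S = L - S" "i \<notin> S" by auto
        with S show "?t (insert i S) = (-1) ^ (invs S (L - S) + invs {i} S) * (x i * f (insert i S) * g (L - S))"
          by (simp add: iL[of S] invs_insert_left[of i S] power_add ac_simps)
      qed
      also have "(\<Sum>S\<in>Pow L. ?t S)
        = (\<Sum>S\<in>Pow L. (-1) ^ (invs S (L - S) + card S + invs {i} (L - S)) * (x i * f S * g (insert i (L - S))))"
      proof (intro sum.cong refl)
        fix S assume S: "S \<in> Pow L"
        with that have e: "insert i L - S = insert i (L - S)" "i \<notin> S" by auto
        \<comment> \<open>Passing d over e_S costs \<open>card S\<close>, by
          \<open>invs_commute\<close>; this is the sign that \<open>grade_inv\<close>
          records.\<close>
        have "invs {i} L + invs S (insert i L - S) = invs S (L - S) + card S + invs {i} (L - S)"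
          using S e that invs_commute[OF e(2)] by (simp add: iL[of S] invs_insert_right[of i "L - S"])
        with e show "?t S = (-1) ^ (invs S (L - S) + card S + invs {i} (L - S)) * (x i * f S * g (insert i (L - S)))"
          by simp
      qed
      finally show ?thesis by (simp add: add.commute)
    qed
    show ?thesis unfolding A_def B_def kdiff_def[of x "kwedge f g"]
      by (simp add: * sum.distrib sum.cartesian_product[symmetric])
  qed
  have split1: "(\<Sum>i\<in>- S. t i) = (\<Sum>i\<in>- L. t i) + (\<Sum>i\<in>L - S. t i)"
    and split2: "(\<Sum>i\<in>- (L - S). t i) = (\<Sum>i\<in>- L. t i) + (\<Sum>i\<in>S. t i)"
    if "S \<subseteq> L" for S and t :: "'a \<Rightarrow> 'b"
  proof -
    have *: "- S = - L \<union> (L - S)" "- (L - S) = - L \<union> S" using that by auto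
    show "(\<Sum>i\<in>- S. t i) = (\<Sum>i\<in>- L. t i) + (\<Sum>i\<in>L - S. t i)"
      by (subst *(1), rule sum.union_disjoint) auto
    show "(\<Sum>i\<in>- (L - S). t i) = (\<Sum>i\<in>- L. t i) + (\<Sum>i\<in>S. t i)"
      using that by (subst *(2), intro sum.union_disjoint) auto
  qed
  have r1: "kwedge (kdiff x f) g L = A + C"
  proof -
    have "kwedge (kdiff x f) g L = (\<Sum>S\<in>Pow L. \<Sum>i\<in>- S. (-1) ^ (invs S (L - S) + invs {i} S) * (x i * f (insert i S) * g (L - S)))"
      unfolding kwedge_def kdiff_def by (simp add: sum_distrib_left sum_distrib_right power_add ac_simps)
    also have "\<dots> = (\<Sum>S\<in>Pow L. (\<Sum>i\<in>- L. (-1) ^ (invs S (L - S) + invs {i} S) * (x i * f (insert i S) * g (L - S)))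
        + (\<Sum>i\<in>L - S. (-1) ^ (invs S (L - S) + invs {i} S) * (x i * f (insert i S) * g (L - S))))"
      by (intro sum.cong refl split1) auto
    also have "\<dots> = A + C"
      unfolding A_def C_def sum.distrib
      by (subst sum.swap) (simp add: sum.cartesian_product sum.Sigma)
    finally show ?thesis .
  qed
  have r2: "kwedge (grade_inv f) (kdiff x g) L = B + D"
  proof -
    have "kwedge (grade_inv f) (kdiff x g) L = (\<Sum>S\<in>Pow L. \<Sum>i\<in>- (L - S). (-1) ^ (invs S (L - S) + card S + invs {i} (L - S)) * (x i * f S * g (insert i (L - S))))"
      unfolding kwedge_def kdiff_def grade_inv_def by (simp add: sum_distrib_left sum_distrib_right power_add ac_simps)
    also have "\<dots> = (\<Sum>S\<in>Pow L. (\<Sum>i\<in>- L. (-1) ^ (invs S (L - S) + card S + invs {i} (L - S)) * (x i * f S * g (insert i (L - S))))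
        + (\<Sum>i\<in>S. (-1) ^ (invs S (L - S) + card S + invs {i} (L - S)) * (x i * f S * g (insert i (L - S)))))"
      by (intro sum.cong refl split2) auto
    also have "\<dots> = B + D"
      unfolding B_def D_def sum.distrib
      by (subst sum.swap) (simp add: sum.cartesian_product sum.Sigma)
    finally show ?thesis .
  qed
  \<comment> \<open>The pair (S, i) of \<open>D\<close> is matched with (S - {i}, i) of
    \<open>C\<close>. Both terms carry the same product of coefficients, and their exponents differ
    by the odd number 1 + 2 * \<open>invs {i} (L - S)\<close>.\<close>
  have "D = - C"
    unfolding C_def D_def sum_negf[symmetric]
  proof (rule sum.reindex_bij_witness[where i = "\<lambda>(S, i). (insert i S, i)" and j = "\<lambda>(S, i). (S - {i}, i)"]; clarsimp)
    fix S i assume *: "S \<subseteq> L" "i \<in> S"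
    define U where "U = S - {i}"
    with * have U: "S = insert i U" "i \<notin> U" "i \<notin> L - insert i U" "L - U = insert i (L - S)"
      by auto
    have e: "invs S (L - S) + card S + invs {i} (L - S)
      = Suc (invs U (L - U) + invs {i} U) + 2 * invs {i} (L - S)"
      unfolding U(4) using U(1,2,3) invs_commute[OF U(2)] by (simp add: invs_insert_left[of i U] invs_insert_right[of i "L - insert i U"])
    have sgn: "(- 1 :: 'b) ^ (invs S (L - S) + card S + invs {i} (L - S)) = - ((-1) ^ (invs U (L - U) + invs {i} U))"
      unfolding e by (simp add: power_add)
    have S: "insert i S = S" using * by auto
    show "- ((- 1) ^ (invs (S - {i}) (L - (S - {i})) + invs {i} (S - {i})) *
           (x i * f (insert i S) * g (L - (S - {i})))) =
        (- 1) ^ (invs S (L - S) + card S + invs {i} (L - S)) * (x i * f S * g (insert i (L - S)))"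
      unfolding U_def[symmetric] sgn U(4)[symmetric] S by simp
  qed (auto simp: insert_absorb)
  with l r1 r2 show "kdiff x (kwedge f g) L = kwedge (kdiff x f) g L + kwedge (grade_inv f) (kdiff x g) L"
    by simp
qed

subsection \<open>Koszul homology of a surjective image\<close>

lemma ring_of_type_algebra_simps [simp]:
  "carrier (ring_of_type_algebra :: 'a::comm_ring_1 ring) = UNIV"
  "x \<otimes>\<^bsub>ring_of_type_algebra\<^esub> y = x * y"
  "x \<oplus>\<^bsub>ring_of_type_algebra\<^esub> y = x + (y :: 'a)"
  "\<one>\<^bsub>ring_of_type_algebra\<^esub> = (1 :: 'a)"
  "\<zero>\<^bsub>ring_of_type_algebra\<^esub> = (0 :: 'a)"
  by (simp_all add: ring_of_type_algebra_def)

lemma uminus_ring_of_type_algebra [simp]: "\<ominus>\<^bsub>ring_of_type_algebra\<^esub> x = - (x :: 'a::comm_ring_1)"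
proof -
  interpret cring "ring_of_type_algebra :: 'a ring" ..
  show ?thesis by (rule minus_equality) auto
qed

lemma koszul_algebra_simps [simp]:
  "carrier (koszul_algebra A) = {f. \<forall>L. f L \<in> carrier A}"
  "f \<otimes>\<^bsub>koszul_algebra A\<^esub> g = koszul_wedge A f g"
  "f \<oplus>\<^bsub>koszul_algebra A\<^esub> g = (\<lambda>L. f L \<oplus>\<^bsub>A\<^esub> g L)"
  "\<one>\<^bsub>koszul_algebra A\<^esub> = koszul_term A \<one>\<^bsub>A\<^esub> {}"
  "\<zero>\<^bsub>koszul_algebra A\<^esub> = (\<lambda>L. \<zero>\<^bsub>A\<^esub>)"
  by (simp_all add: koszul_algebra_def)

text \<open>Chains over \<open>A\<close> are computed with through lifts along the surjection \<open>h\<close>, so that the sums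
  and signs live in a type class.\<close>

locale koszul_image = ring_hom_cring ring_of_type_algebra A h
  for A and h :: "'a::comm_ring_1 \<Rightarrow> 'b" +
  fixes x :: "'i::{finite,linorder} \<Rightarrow> 'a"
  assumes surj: "range h = carrier A"
begin

abbreviation K :: "('i set \<Rightarrow> 'b) ring" where "K \<equiv> koszul_algebra A"
abbreviation Z :: "('i set \<Rightarrow> 'b) ring" where "Z \<equiv> koszul_cycle_ring A (\<lambda>i. h (x i))"
abbreviation B :: "('i set \<Rightarrow> 'b) set" where "B \<equiv> koszul_boundaries A (\<lambda>i. h (x i))"
abbreviation H :: "('i set \<Rightarrow> 'b) set ring" where "H \<equiv> koszul_homology A (\<lambda>i. h (x i))"

definition lift :: "('i set \<Rightarrow> 'a) \<Rightarrow> 'i set \<Rightarrow> 'b" where "lift F = (\<lambda>L. h (F L))"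

definition cycle :: "('i set \<Rightarrow> 'a) \<Rightarrow> bool" where
  "cycle F \<longleftrightarrow> (\<forall>L. h (kdiff x F L) = \<zero>\<^bsub>A\<^esub>)"

definition cls :: "('i set \<Rightarrow> 'a) \<Rightarrow> ('i set \<Rightarrow> 'b) set" where
  "cls F = koszul_class A (\<lambda>i. h (x i)) (lift F)"

lemma h_closed [simp]: "h a \<in> carrier A"
  using surj by blast

lemma h_simps: "h (a + b) = h a \<oplus>\<^bsub>A\<^esub> h b" "h (a * b) = h a \<otimes>\<^bsub>A\<^esub> h b"
  "h 0 = \<zero>\<^bsub>A\<^esub>" "h 1 = \<one>\<^bsub>A\<^esub>" "h (- a) = \<ominus>\<^bsub>A\<^esub> h a"
  using hom_add[of a b] hom_mult[of a b] hom_zero hom_one hom_a_inv[of a] by simp_all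

lemma h_sum: "finite S \<Longrightarrow> h (sum f S) = (\<Oplus>\<^bsub>A\<^esub>i\<in>S. h (f i))"
  by (induction S rule: finite_induct) (simp_all add: h_simps)

lemma koszul_sign_eq: "koszul_sign A k = h ((-1) ^ k)"
  by (induction k) (simp_all add: koszul_sign_def h_simps S.r_minus)

lemma carrier_K: "carrier K = range lift"
proof (intro equalityI subsetI)
  fix f assume "f \<in> carrier K"
  then have "\<forall>L. \<exists>a. f L = h a" using surj by (auto simp: image_iff)
  then obtain F where "\<forall>L. f L = h (F L)" by metis
  then show "f \<in> range lift" by (auto simp: lift_def)
qed (auto simp: lift_def)

lemma koszul_wedge_lift: "koszul_wedge A (lift F) (lift G) = lift (kwedge F G)"
  by (simp add: koszul_wedge_def kwedge_def lift_def h_sum h_simps koszul_sign_eq invs_eq_card)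

lemma koszul_diff_lift: "koszul_diff A (\<lambda>i. h (x i)) (lift F) = lift (kdiff x F)"
  by (simp add: koszul_diff_def kdiff_def lift_def h_sum h_simps koszul_sign_eq invs_singleton_eq_card)

lemma koszul_term_lift: "koszul_term A (h a) L = lift (kterm L a)"
  by (auto simp: koszul_term_def kterm_def lift_def h_simps)

lemma lift_simps:
  "lift F \<otimes>\<^bsub>K\<^esub> lift G = lift (kwedge F G)"
  "lift F \<oplus>\<^bsub>K\<^esub> lift G = lift (\<lambda>L. F L + G L)"
  "\<one>\<^bsub>K\<^esub> = lift (kterm {} 1)"
  "\<zero>\<^bsub>K\<^esub> = lift (\<lambda>L. 0)"
proof -
  show "\<one>\<^bsub>K\<^esub> = lift (kterm {} 1)"
    using koszul_term_lift[of 1 "{}"] by (simp add: h_simps)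
qed (simp add: koszul_wedge_lift, simp_all add: lift_def h_simps)

text \<open>Every chain over A is a lift, so each ring axiom is an identity for
  \<open>kwedge\<close> or for pointwise addition, pushed through \<open>lift\<close>.\<close>

lemma ring_K: "ring K"
proof (rule ringI)
  show "abelian_group K"
  proof (rule abelian_groupI, unfold carrier_K)
    fix f assume "f \<in> range lift"
    then obtain F where "f = lift F" by auto
    then have "lift (\<lambda>L. - F L) \<oplus>\<^bsub>K\<^esub> f = \<zero>\<^bsub>K\<^esub>" by (simp only: lift_simps) simp
    then show "\<exists>g\<in>range lift. g \<oplus>\<^bsub>K\<^esub> f = \<zero>\<^bsub>K\<^esub>" by blast
  qed (auto simp only: lift_simps add.assoc add.commute add.left_commute add_0_left intro!: rangeI)
  show "monoid K"
    by (rule monoidI; unfold carrier_K)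
      (auto simp only: lift_simps kwedge_assoc kwedge_one_left kwedge_one_right intro!: rangeI)
qed (unfold carrier_K, auto simp only: lift_simps kwedge_add_left kwedge_add_right)

interpretation K: ring K by (rule ring_K)

lemma uminus_lift: "\<ominus>\<^bsub>K\<^esub> lift F = lift (\<lambda>L. - F L)"
proof (rule K.minus_equality)
  show "lift (\<lambda>L. - F L) \<oplus>\<^bsub>K\<^esub> lift F = \<zero>\<^bsub>K\<^esub>" unfolding lift_simps by simp
qed (auto simp: lift_def)

lemma carrier_Z: "carrier Z = {lift F | F. cycle F}"
proof -
  have "carrier Z = {f \<in> range lift. koszul_diff A (\<lambda>i. h (x i)) f = (\<lambda>L. \<zero>\<^bsub>A\<^esub>)}"
    by (simp add: koszul_cycle_ring_def koszul_cycles_def flip: carrier_K)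
  also have "\<dots> = {lift F | F. cycle F}"
    by (auto simp: koszul_diff_lift) (auto simp: cycle_def lift_def fun_eq_iff)
  finally show ?thesis .
qed

lemma Z_eq: "Z = K\<lparr>carrier := carrier Z\<rparr>"
  by (simp add: koszul_cycle_ring_def)

lemma Z_simps:
  "lift F \<otimes>\<^bsub>Z\<^esub> lift G = lift (kwedge F G)"
  "lift F \<oplus>\<^bsub>Z\<^esub> lift G = lift (\<lambda>L. F L + G L)"
  "\<one>\<^bsub>Z\<^esub> = lift (kterm {} 1)"
  "\<zero>\<^bsub>Z\<^esub> = lift (\<lambda>L. 0)"
  unfolding lift_simps[symmetric] by (simp_all add: koszul_cycle_ring_def)

text \<open>Only the image of F vanishes, not F itself, so the product has to be computed in
  \<open>K\<close>.\<close>

lemma lift_kwedge_zero_left: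
  assumes "lift F = \<zero>\<^bsub>K\<^esub>" shows "lift (kwedge F G) = \<zero>\<^bsub>K\<^esub>"
proof -
  have "lift (kwedge F G) = lift F \<otimes>\<^bsub>K\<^esub> lift G" by (simp only: lift_simps)
  also have "\<dots> = \<zero>\<^bsub>K\<^esub>" unfolding assms by (intro K.l_null) (auto simp: lift_def)
  finally show ?thesis .
qed

lemma lift_kwedge_zero_right:
  assumes "lift G = \<zero>\<^bsub>K\<^esub>" shows "lift (kwedge F G) = \<zero>\<^bsub>K\<^esub>"
proof -
  have "lift (kwedge F G) = lift F \<otimes>\<^bsub>K\<^esub> lift G" by (simp only: lift_simps)
  also have "\<dots> = \<zero>\<^bsub>K\<^esub>" unfolding assms by (intro K.r_null) (auto simp: lift_def)
  finally show ?thesis .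
qed

section \<open>The ring of cycles, its ideal of boundaries, and homology classes\<close>

lemma cycle_iff: "cycle F \<longleftrightarrow> lift (kdiff x F) = \<zero>\<^bsub>K\<^esub>"
  by (auto simp: cycle_def lift_def fun_eq_iff)

lemma cycle_add: "cycle F \<Longrightarrow> cycle G \<Longrightarrow> cycle (\<lambda>L. F L + G L)"
  by (simp add: cycle_def kdiff_add h_simps)

lemma cycle_uminus: "cycle F \<Longrightarrow> cycle (\<lambda>L. - F L)"
  by (simp add: cycle_def kdiff_uminus h_simps)

lemma cycle_kwedge:
  assumes "cycle F" "cycle G" shows "cycle (kwedge F G)"
proof -
  have "lift (kdiff x (kwedge F G))
    = lift (kwedge (kdiff x F) G) \<oplus>\<^bsub>K\<^esub> lift (kwedge (grade_inv F) (kdiff x G))"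
    unfolding lift_simps kdiff_kwedge ..
  also have "\<dots> = \<zero>\<^bsub>K\<^esub>"
    using assms lift_kwedge_zero_left lift_kwedge_zero_right unfolding cycle_iff by simp
  finally show ?thesis unfolding cycle_iff .
qed

lemma cycle_kdiff: "cycle (kdiff x F)"
  by (simp add: cycle_def kdiff_kdiff h_simps)

lemma cycle_scalar: "cycle (kterm {} a)"
  by (simp add: cycle_def kdiff_def kterm_def h_simps)

lemma cycle_grade_inv: "cycle F \<Longrightarrow> cycle (grade_inv F)"
  by (simp add: cycle_def kdiff_grade_inv h_simps) (simp add: grade_inv_def h_simps)

lemma subring_Z: "subring (carrier Z) K"
proof (rule K.subringI)
  show "\<one>\<^bsub>K\<^esub> \<in> carrier Z" unfolding lift_simps carrier_Z using cycle_scalar by blast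
qed (unfold carrier_Z carrier_K, auto simp only: lift_simps uminus_lift
    intro: cycle_add cycle_uminus cycle_kwedge)

lemma ring_Z: "ring Z"
  using K.subring_is_ring[OF subring_Z] by (simp flip: Z_eq)

interpretation Z: ring Z by (rule ring_Z)

lemma uminus_Z: "cycle F \<Longrightarrow> \<ominus>\<^bsub>Z\<^esub> lift F = lift (\<lambda>L. - F L)"
proof (rule Z.minus_equality)
  show "lift (\<lambda>L. - F L) \<oplus>\<^bsub>Z\<^esub> lift F = \<zero>\<^bsub>Z\<^esub>" unfolding Z_simps by simp
qed (auto simp: carrier_Z intro: cycle_uminus)

lemma B_eq: "B = {lift (kdiff x F) | F. True}"
  unfolding koszul_boundaries_def carrier_K image_image koszul_diff_lift by auto

lemma lift_add_zero_left: "lift F = \<zero>\<^bsub>K\<^esub> \<Longrightarrow> lift (\<lambda>L. F L + G L) = lift G"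
  by (simp add: lift_def h_simps fun_eq_iff)

lemma lift_add_zero_right: "lift G = \<zero>\<^bsub>K\<^esub> \<Longrightarrow> lift (\<lambda>L. F L + G L) = lift F"
  by (simp add: lift_def h_simps fun_eq_iff)

lemma grade_inv_grade_inv: "grade_inv (grade_inv F) = F"
  by (simp add: grade_inv_def flip: mult.assoc)

text \<open>By the Leibniz rule the product of dF with a cycle G is d(F G), since the other summand
  has a factor with image zero.\<close>

lemma ideal_B: "ideal B Z"
proof (rule idealI)
  show "ring Z" by (rule ring_Z)
  show "subgroup B (add_monoid Z)"
  proof (rule Z.add.subgroupI)
    fix b assume "b \<in> B"
    then obtain F where b: "b = lift (kdiff x F)" by (auto simp: B_eq)
    have "\<ominus>\<^bsub>Z\<^esub> b = lift (kdiff x (\<lambda>L. - F L))"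
      unfolding b uminus_Z[OF cycle_kdiff] kdiff_uminus ..
    then show "\<ominus>\<^bsub>Z\<^esub> b \<in> B" by (auto simp: B_eq)
    fix c assume "c \<in> B"
    then obtain G where c: "c = lift (kdiff x G)" by (auto simp: B_eq)
    have "b \<oplus>\<^bsub>Z\<^esub> c = lift (kdiff x (\<lambda>L. F L + G L))"
      unfolding b c Z_simps kdiff_add ..
    then show "b \<oplus>\<^bsub>Z\<^esub> c \<in> B" by (auto simp: B_eq)
  qed (auto simp: B_eq carrier_Z intro: cycle_kdiff)
next
  fix b z assume "b \<in> B" "z \<in> carrier Z"
  then obtain F G where b: "b = lift (kdiff x F)" and z: "z = lift G" "cycle G"
    by (auto simp: B_eq carrier_Z)
  have "b \<otimes>\<^bsub>Z\<^esub> z = lift (kdiff x (kwedge F G))"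
    unfolding b z Z_simps kdiff_kwedge
    using lift_add_zero_right[OF lift_kwedge_zero_right] z(2) unfolding cycle_iff by simp
  then show "b \<otimes>\<^bsub>Z\<^esub> z \<in> B" by (auto simp: B_eq)
  \<comment> \<open>On this side the Leibniz rule twists the left factor, so it is twisted
    beforehand; \<open>grade_inv\<close> is an involution and preserves cycles.\<close>
  have "z \<otimes>\<^bsub>Z\<^esub> b = lift (kdiff x (kwedge (grade_inv G) F))"
    unfolding b z Z_simps kdiff_kwedge grade_inv_grade_inv
    using lift_add_zero_left[OF lift_kwedge_zero_left] cycle_grade_inv[OF z(2)] unfolding cycle_iff by simp
  then show "z \<otimes>\<^bsub>Z\<^esub> b \<in> B" by (auto simp: B_eq)
qed

interpretation B: ideal B Z by (rule ideal_B)

lemma ring_H: "ring H"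
  unfolding koszul_homology_def by (rule B.quotient_is_ring)

interpretation H: ring H by (rule ring_H)

lemma cls_eq: "cls F = B +>\<^bsub>Z\<^esub> lift F"
  by (simp add: cls_def koszul_class_def)

lemma lift_in_Z: "cycle F \<Longrightarrow> lift F \<in> carrier Z"
  by (auto simp: carrier_Z)

lemma carrier_H: "carrier H = {cls F | F. cycle F}"
  by (auto simp: koszul_homology_def FactRing_def A_RCOSETS_def' carrier_Z cls_eq)

lemma cls_add: "cycle F \<Longrightarrow> cycle G \<Longrightarrow> cls F \<oplus>\<^bsub>H\<^esub> cls G = cls (\<lambda>L. F L + G L)"
  using B.a_rcos_sum[OF lift_in_Z lift_in_Z, of F G]
  by (simp add: koszul_homology_def FactRing_def cls_eq Z_simps)

lemma cls_kwedge: "cycle F \<Longrightarrow> cycle G \<Longrightarrow> cls F \<otimes>\<^bsub>H\<^esub> cls G = cls (kwedge F G)"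
  using B.rcoset_mult_add[OF lift_in_Z lift_in_Z, of F G]
  by (simp add: koszul_homology_def FactRing_def cls_eq Z_simps)

lemma cls_kdiff: "cls (kdiff x F) = \<zero>\<^bsub>H\<^esub>"
  using B.a_rcos_const[of "lift (kdiff x F)"]
  by (auto simp: koszul_homology_def FactRing_def cls_eq B_eq)

lemma cls_in_H: "cycle F \<Longrightarrow> cls F \<in> carrier H"
  by (auto simp: carrier_H)

text \<open>Equality is asked for only after applying \<open>h\<close>, so the lifts may differ by
  anything in its kernel.\<close>

lemma cls_eqI:
  assumes "\<And>L. h (F L) = h (kdiff x Y L + G L)" "cycle G"
  shows "cls F = cls G"
proof -
  have "lift F = lift (\<lambda>L. kdiff x Y L + G L)"
    by (simp add: lift_def assms(1))
  then have "cls F = cls (\<lambda>L. kdiff x Y L + G L)" by (simp add: cls_eq)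
  also have "\<dots> = cls (kdiff x Y) \<oplus>\<^bsub>H\<^esub> cls G"
    using cls_add[OF cycle_kdiff assms(2)] by simp
  finally have "cls F = cls (kdiff x Y) \<oplus>\<^bsub>H\<^esub> cls G" .
  then show ?thesis using cls_in_H[OF assms(2)] by (simp add: cls_kdiff)
qed

end

subsection \<open>Edge ideals\<close>

lemma poly_mapping_sum_single: "p = (\<Sum>u\<in>Poly_Mapping.keys p. Poly_Mapping.single u (Poly_Mapping.lookup p u))"
proof (rule poly_mapping_eqI)
  fix v
  have "(\<Sum>u\<in>Poly_Mapping.keys p. Poly_Mapping.lookup (Poly_Mapping.single u (Poly_Mapping.lookup p u)) v)
    = (\<Sum>u\<in>Poly_Mapping.keys p. if u = v then Poly_Mapping.lookup p v else 0)"
    by (intro sum.cong) (auto simp: lookup_single)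
  then show "Poly_Mapping.lookup p v = Poly_Mapping.lookup
      (\<Sum>u\<in>Poly_Mapping.keys p. Poly_Mapping.single u (Poly_Mapping.lookup p u)) v"
    by (simp add: lookup_sum in_keys_iff)
qed

interpretation poly_ring: cring "poly_ring :: ('n, 'k::field) mpoly ring" ..

lemma monomial_ideal_ideal: "ideal (monomial_ideal G) (poly_ring :: ('n, 'k::field) mpoly ring)"
  unfolding monomial_ideal_def by (rule poly_ring.genideal_ideal) simp

text \<open>The polynomials all of whose exponents are divisible by a generator form an ideal
  containing the generators, hence contain the generated ideal. Conversely every single term of such
  a polynomial is a multiple of a generator.\<close>

lemma mem_monomial_ideal_iff:
  fixes p :: "('n, 'k::field) mpoly"
  shows "p \<in> monomial_ideal G \<longleftrightarrow> (\<forall>u\<in>Poly_Mapping.keys p. \<exists>g\<in>G. \<exists>v. u = v + g)"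
proof
  let ?J = "{p :: ('n, 'k) mpoly. \<forall>u\<in>Poly_Mapping.keys p. \<exists>g\<in>G. \<exists>v. u = v + g}"
  have mult: "q * p \<in> ?J" if "p \<in> ?J" for p q
  proof -
    { fix u assume "u \<in> Poly_Mapping.keys (q * p)"
      then obtain a b where u: "u = a + b" "b \<in> Poly_Mapping.keys p" using keys_mult[of q p] by blast
      with that obtain g v where "g \<in> G" "b = v + g" by blast
      with u have "u = (a + v) + g" by (simp add: add.assoc)
      with \<open>g \<in> G\<close> have "\<exists>g\<in>G. \<exists>v. u = v + g" by blast }
    then show ?thesis by blast
  qed
  have "ideal ?J poly_ring"
  proof (rule idealI)
    show "subgroup ?J (add_monoid poly_ring)"
    proof (rule poly_ring.add.subgroupI)
      fix p q assume "p \<in> ?J" "q \<in> ?J"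
      then show "p \<oplus>\<^bsub>poly_ring\<^esub> q \<in> ?J" using keys_add[of p q] by fastforce
      show "\<ominus>\<^bsub>poly_ring\<^esub> p \<in> ?J" using mult[OF \<open>p \<in> ?J\<close>, of "-1"] by simp
    qed (auto intro: exI[of _ 0])
  next
    show "ring (poly_ring :: ('n, 'k) mpoly ring)" by (rule poly_ring.ring_axioms)
    fix p q :: "('n, 'k) mpoly" assume "p \<in> ?J"
    with mult show "q \<otimes>\<^bsub>poly_ring\<^esub> p \<in> ?J" by simp
    with \<open>p \<in> ?J\<close> mult show "p \<otimes>\<^bsub>poly_ring\<^esub> q \<in> ?J" by (simp add: mult.commute)
  qed
  moreover have "monomial ` G \<subseteq> ?J" by (auto simp: monomial_def intro!: bexI exI[of _ 0])
  ultimately have "monomial_ideal G \<subseteq> ?J"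
    unfolding monomial_ideal_def by (rule poly_ring.genideal_minimal)
  then show "p \<in> monomial_ideal G \<Longrightarrow> \<forall>u\<in>Poly_Mapping.keys p. \<exists>g\<in>G. \<exists>v. u = v + g" by blast
next
  interpret ideal "monomial_ideal G" "poly_ring :: ('n, 'k) mpoly ring"
    by (rule monomial_ideal_ideal)
  assume p: "\<forall>u\<in>Poly_Mapping.keys p. \<exists>g\<in>G. \<exists>v. u = v + g"
  have single: "Poly_Mapping.single u c \<in> monomial_ideal G" if "u \<in> Poly_Mapping.keys p" for u and c :: 'k
  proof -
    from p that obtain g v where g: "g \<in> G" "u = v + g" by blast
    have "monomial g \<in> (monomial_ideal G :: ('n, 'k) mpoly set)"
      unfolding monomial_ideal_def using g(1) by (intro subsetD[OF poly_ring.genideal_self]) auto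
    from I_l_closed[OF this, of "Poly_Mapping.single v c"] show ?thesis
      by (simp add: g(2) monomial_def mult_single)
  qed
  have "(\<Sum>u\<in>S. Poly_Mapping.single u (Poly_Mapping.lookup p u)) \<in> monomial_ideal G"
    if "S \<subseteq> Poly_Mapping.keys p" for S
    using finite_subset[OF that finite_keys] that
  proof (induction S rule: finite_induct)
    case empty
    then show ?case using additive_subgroup.zero_closed[OF additive_subgroup_axioms] by simp
  next
    case (insert u S)
    then show ?case using a_closed[OF single insert.IH] by simp
  qed
  then show "p \<in> monomial_ideal G" by (subst poly_mapping_sum_single) blast
qed

lemma lookup_facet_expo: "Poly_Mapping.lookup (facet_expo F :: 'n::finite expo) i = of_bool (i \<in> F)"
proof -
  have "Poly_Mapping.lookup (facet_expo F) i = (\<Sum>j\<in>F. if j = i then 1 else 0)"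
    unfolding facet_expo_def lookup_sum by (intro sum.cong) (auto simp: lookup_single)
  then show ?thesis by simp
qed

text \<open>A squarefree monomial divides another one exactly when its support is contained in the
  support of the other. Membership in an edge ideal thus becomes a condition on supports.\<close>

lemma facet_expo_le_iff:
  "(\<exists>v. (u :: 'n::finite expo) = v + facet_expo F) \<longleftrightarrow> F \<subseteq> Poly_Mapping.keys u"
proof
  assume "F \<subseteq> Poly_Mapping.keys u"
  then have "u = (u - facet_expo F) + facet_expo F"
    by (intro poly_mapping_eqI) (auto simp: lookup_add lookup_minus lookup_facet_expo in_keys_iff)
  then show "\<exists>v. u = v + facet_expo F" by blast
qed (auto simp: in_keys_iff lookup_add lookup_facet_expo)

lemma mem_facet_ideal_iff:
  fixes p :: "('n::finite, 'k::field) mpoly"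
  shows "p \<in> facet_ideal E \<longleftrightarrow> (\<forall>u\<in>Poly_Mapping.keys p. \<exists>e\<in>E. e \<subseteq> Poly_Mapping.keys u)"
  by (simp add: facet_ideal_def facet_generators_def mem_monomial_ideal_iff facet_expo_le_iff)

lemma expo_degree_add: "expo_degree (u + v) = expo_degree u + expo_degree v"
  by (simp add: expo_degree_def lookup_add sum.distrib)

lemma expo_degree_single [simp]: "expo_degree (Poly_Mapping.single i k) = k"
  by (simp add: expo_degree_def lookup_single when_def)

lemma expo_degree_facet_expo: "expo_degree (facet_expo F) = card F"
  by (simp add: expo_degree_def lookup_facet_expo)

text \<open>Nonemptiness fixes the least degree of a generator as 2. Acyclicity enters later,
  through the leaf hypothesis of \<open>chain_gen\<close>.\<close>

locale edge_ideal =
  fixes E :: "'n::{finite,linorder} set set" and I :: "('n, 'k::field) mpoly set"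
  assumes simple: "simple_graph E" and nonempty: "E \<noteq> {}" and I_eq: "I = facet_ideal E"
begin

interpretation ideal I poly_ring
  unfolding I_eq facet_ideal_def by (rule monomial_ideal_ideal)

sublocale koszul_image "poly_ring Quot I" "residue I" var
proof (intro koszul_image.intro koszul_image_axioms.intro)
  show "ring_hom_cring poly_ring (poly_ring Quot I) (residue I)"
    by (rule rcos_ring_hom_cring[OF poly_ring.is_cring])
  show "range (residue I) = carrier (poly_ring Quot I)"
    by (auto simp: FactRing_def A_RCOSETS_def')
qed

lemma mem_I_iff: "p \<in> I \<longleftrightarrow> (\<forall>u\<in>Poly_Mapping.keys p. \<exists>e\<in>E. e \<subseteq> Poly_Mapping.keys u)"
  by (simp add: I_eq mem_facet_ideal_iff)

lemma residue_eq_zero_iff: "residue I p = \<zero>\<^bsub>poly_ring Quot I\<^esub> \<longleftrightarrow> p \<in> I"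
proof
  assume "residue I p = \<zero>\<^bsub>poly_ring Quot I\<^esub>"
  then have "I +>\<^bsub>poly_ring\<^esub> p = I" by (simp add: FactRing_def)
  then show "p \<in> I" using a_rcos_self[of p] by simp
next
  assume "p \<in> I"
  then show "residue I p = \<zero>\<^bsub>poly_ring Quot I\<^esub>" using a_rcos_const by (simp add: FactRing_def)
qed

lemma cycle_iff_I: "cycle F \<longleftrightarrow> (\<forall>L. kdiff var F L \<in> I)"
  by (simp add: cycle_def residue_eq_zero_iff)

lemma zero_I: "0 \<in> I"
  by (simp add: mem_I_iff)

lemma add_I: "p \<in> I \<Longrightarrow> q \<in> I \<Longrightarrow> p + q \<in> I"
  by (auto simp: mem_I_iff dest!: subsetD[OF keys_add])

lemma mult_I: "p \<in> I \<Longrightarrow> q * p \<in> I"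
  using I_l_closed by simp

lemma sum_I: "(\<And>i. i \<in> S \<Longrightarrow> f i \<in> I) \<Longrightarrow> sum f S \<in> I"
  by (induction S rule: infinite_finite_induct) (auto intro: zero_I add_I)

lemma quot_homology_eq: "quot_homology I = H"
  by (simp add: quot_homology_def)

lemma quot_class_lift: "quot_class I (lift F) = cls F"
  by (simp add: quot_class_def cls_def)

text \<open>A property of polynomial chains instead of homology classes, so that the induction can
  split and factor chains over R itself.\<close>

definition gen :: "('n set \<Rightarrow> ('n, 'k) mpoly) set" where
  "gen = {F. cycle F \<and>
     cls F \<in> generated_subalgebra I (quot_class I ` linear_monomial_cycles (facet_generators E))}"

lemma gen_cycle: "F \<in> gen \<Longrightarrow> cycle F"
  by (simp add: gen_def)

lemma gen_add: "F \<in> gen \<Longrightarrow> G \<in> gen \<Longrightarrow> (\<lambda>L. F L + G L) \<in> gen"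
  unfolding gen_def generated_subalgebra_def quot_homology_eq
  by (auto intro: cycle_add simp flip: cls_add intro: generate_ring.eng_add)

lemma gen_kwedge: "F \<in> gen \<Longrightarrow> G \<in> gen \<Longrightarrow> kwedge F G \<in> gen"
  unfolding gen_def generated_subalgebra_def quot_homology_eq
  by (auto intro: cycle_kwedge simp flip: cls_kwedge intro: generate_ring.eng_mult)

lemma gen_homologous:
  assumes "cycle F" "G \<in> gen" "\<And>L. F L - (kdiff var Y L + G L) \<in> I"
  shows "F \<in> gen"
proof -
  have "residue I (F L) = residue I (kdiff var Y L + G L)" for L
  proof -
    have "residue I (F L - (kdiff var Y L + G L)) = \<zero>\<^bsub>poly_ring Quot I\<^esub>"
      using assms(3) by (simp add: residue_eq_zero_iff)
    then have "residue I (F L - (kdiff var Y L + G L) + (kdiff var Y L + G L))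
       = residue I (kdiff var Y L + G L)"
      by (simp only: h_simps(1)) simp
    then show ?thesis by simp
  qed
  then have "cls F = cls G" using assms(2) by (intro cls_eqI) (auto simp: gen_def)
  with assms show ?thesis by (simp add: gen_def)
qed

lemma gen_scalar: "kterm {} (const c) \<in> gen"
proof -
  have "cls (kterm {} (const c)) = quot_class I (koszul_term (poly_ring Quot I) (residue I (const c)) {})"
    by (simp add: koszul_term_lift quot_class_lift)
  then have "cls (kterm {} (const c)) \<in> scalar_classes I"
    unfolding scalar_classes_def by blast
  then show ?thesis
    by (auto simp: gen_def generated_subalgebra_def intro: generate_ring.incl cycle_scalar)
qed

text \<open>The coefficients of d(x_w e_M) are, up to sign, the products x_i x_w with i in M, and
  these are generators of I.\<close>

lemma gen_linear:
  assumes "\<And>i. i \<in> M \<Longrightarrow> {w, i} \<in> E"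
  shows "kterm M (var w) \<in> gen"
proof -
  let ?u = "Poly_Mapping.single w (1 :: nat)"
  have *: "var i * var w \<in> I" if "i \<in> M" for i
  proof -
    have "w \<noteq> i" using assms[OF that] simple by (auto simp: simple_graph_def)
    then have "Poly_Mapping.keys (Poly_Mapping.single i 1 + ?u) = {w, i}"
      by (auto simp: in_keys_iff lookup_add lookup_single when_def split: if_splits)
    then show ?thesis using assms[OF that] by (auto simp: mem_I_iff var_def monomial_def mult_single)
  qed
  have "kdiff var (kterm M (var w)) L \<in> I" for L
    unfolding kdiff_def
  proof (intro sum_I mult_I[of "_ * _"])
    fix i show "var i * kterm M (var w) (insert i L) \<in> I"
      using * by (auto simp: kterm_def zero_I)
  qed
  then have cyc: "cycle (kterm M (var w))" by (simp add: cycle_iff_I)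
  have lift: "lift (kterm M (var w)) = koszul_term (poly_ring Quot I) (residue I (monomial ?u)) M"
    by (simp add: koszul_term_lift var_def)
  have "is_monomial_cycle I ?u M"
    using lift_in_Z[OF cyc] unfolding lift is_monomial_cycle_def by (simp add: koszul_cycle_ring_def)
  moreover have "(LEAST d. \<exists>g\<in>facet_generators E. expo_degree g = d) = 2"
  proof -
    have "expo_degree g = 2" if "g \<in> facet_generators E" for g
      using that simple by (auto simp: facet_generators_def expo_degree_facet_expo simple_graph_def)
    moreover obtain g where "g \<in> facet_generators E"
      using nonempty by (auto simp: facet_generators_def)
    ultimately show ?thesis by (intro Least_equality) auto
  qed
  ultimately have "lift (kterm M (var w)) \<in> linear_monomial_cycles (facet_generators E)"
    unfolding lift linear_monomial_cycles_def I_eq[unfolded facet_ideal_def, symmetric]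
    by (intro CollectI exI[of _ ?u] exI[of _ M]) simp
  then have "cls (kterm M (var w)) \<in> quot_class I ` linear_monomial_cycles (facet_generators E)"
    unfolding quot_class_lift[symmetric] by (rule imageI)
  with cyc show ?thesis
    by (auto simp: gen_def generated_subalgebra_def intro: generate_ring.incl)
qed

end

subsection \<open>Multigraded pieces\<close>

text \<open>The chain \<open>\<Sum>\<^sub>L c(L) x\<^bsup>a - L\<^esup> e\<^sub>L\<close> of multidegree \<open>a\<close>. The case distinction matters because the
  subtraction of exponents is truncated.\<close>

definition chain :: "'n::finite expo \<Rightarrow> ('n set \<Rightarrow> 'k) \<Rightarrow> 'n set \<Rightarrow> ('n, 'k::field) mpoly" where
  "chain a c = (\<lambda>L. if L \<subseteq> Poly_Mapping.keys a then Poly_Mapping.single (a - facet_expo L) (c L) else 0)"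

text \<open>In a fixed multidegree L determines the monomial, so d becomes the augmented boundary
  map of the full simplex on the support of a.\<close>

definition chain_diff :: "'n::{finite,linorder} expo \<Rightarrow> ('n set \<Rightarrow> 'k::field) \<Rightarrow> 'n set \<Rightarrow> 'k" where
  "chain_diff a c L = (\<Sum>i\<in>Poly_Mapping.keys a - L. (-1) ^ invs {i} L * c (insert i L))"

text \<open>Exterior multiplication by \<open>e\<^sub>v / x\<^sub>v\<close> on coefficients.\<close>

definition cone :: "'n::{finite,linorder} \<Rightarrow> ('n set \<Rightarrow> 'k::field) \<Rightarrow> 'n set \<Rightarrow> 'k" where
  "cone v c L = (if v \<in> L then (-1) ^ invs {v} (L - {v}) * c (L - {v}) else 0)"

lemma sign_mult_single:
  "(-1) ^ k * (Poly_Mapping.single u c :: ('n, 'k::field) mpoly) = Poly_Mapping.single u ((-1) ^ k * c)"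
  by (cases "even k") (simp_all add: single_uminus)

lemma single_sum: "Poly_Mapping.single u (sum f S) = (\<Sum>i\<in>S. Poly_Mapping.single u (f i))"
  by (induction S rule: infinite_finite_induct) (simp_all add: single_add)

lemma chain_minus: "chain a c L - chain a d L = chain a (\<lambda>L. c L - d L) L"
  by (simp add: chain_def single_diff)

lemma chain_plus: "chain a c L + chain a d L = chain a (\<lambda>L. c L + d L) L"
  by (simp add: chain_def single_add)

lemma kdiff_chain: "kdiff var (chain a c) = chain a (chain_diff a c)"
proof
  fix L :: "'a set"
  show "kdiff var (chain a c) L = chain a (chain_diff a c) L"
  proof (cases "L \<subseteq> Poly_Mapping.keys a")
    case True
    let ?t = "\<lambda>i. Poly_Mapping.single (a - facet_expo L) ((-1) ^ invs {i} L * c (insert i L))"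
    have "(-1) ^ invs {i} L * (var i * chain a c (insert i L))
      = (if i \<in> Poly_Mapping.keys a then ?t i else 0)" if "i \<in> - L" for i
    proof (cases "i \<in> Poly_Mapping.keys a")
      case i: True
      \<comment> \<open>Truncated subtraction does no harm here: i lies in the support of a and
        outside L.\<close>
      have "Poly_Mapping.single i 1 + (a - facet_expo (insert i L)) = a - facet_expo L"
        using that i by (intro poly_mapping_eqI)
          (auto simp: lookup_add lookup_minus lookup_single lookup_facet_expo in_keys_iff when_def)
      with i True show ?thesis
        by (simp add: chain_def var_def monomial_def mult_single sign_mult_single)
    qed (simp add: chain_def)
    then have "kdiff var (chain a c) L = (\<Sum>i\<in>- L. if i \<in> Poly_Mapping.keys a then ?t i else 0)"
      unfolding kdiff_def by (intro sum.cong) auto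
    also have "\<dots> = sum ?t (Poly_Mapping.keys a - L)"
      by (simp add: sum.If_cases Int_commute Diff_eq)
    finally show ?thesis using True by (simp add: chain_def chain_diff_def single_sum)
  qed (auto simp: chain_def kdiff_def intro!: sum.neutral)
qed

text \<open>The simplex is contracted to its vertex v. If v is not in L, only the summand i = v of
  the first term survives. If v is in L, the two sums over i outside L cancel and the summand i = v
  of the second term leaves \<open>c L\<close>.\<close>

lemma chain_diff_cone:
  assumes v: "v \<in> Poly_Mapping.keys a"
  shows "chain_diff a (cone v c) L + cone v (chain_diff a c) L = c L"
proof (cases "v \<in> L")
  case False
  have "chain_diff a (cone v c) L = (\<Sum>i\<in>Poly_Mapping.keys a - L. if i = v then c L else 0)"
    unfolding chain_diff_def
  proof (intro sum.cong refl)
    fix i show "(-1) ^ invs {i} L * cone v c (insert i L) = (if i = v then c L else 0)"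
      using False by (auto simp: cone_def simp flip: mult.assoc)
  qed
  with False v show ?thesis by (simp add: cone_def)
next
  case True
  define U where "U = L - {v}"
  have U: "L = insert v U" "v \<notin> U" using True by (auto simp: U_def)
  let ?s = "(-1) ^ invs {v} U"
  let ?t = "\<lambda>i. (-1) ^ invs {i} U * c (insert i U)"
  have "chain_diff a (cone v c) L = (\<Sum>i\<in>Poly_Mapping.keys a - L. - (?s * ?t i))"
    unfolding chain_diff_def
  proof (intro sum.cong refl)
    fix i assume i: "i \<in> Poly_Mapping.keys a - L"
    with U have iU: "i \<notin> U" "i \<noteq> v" by auto
    have *: "insert i L - {v} = insert i U" using U iU by auto
    have "invs {v} {i} + invs {i} {v} = 1" using invs_commute[of v "{i}"] iU by simp
    \<comment> \<open>Exchanging e_i and e_v shifts the exponent by one, which makes the two sums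
      opposite.\<close>
    then have e: "invs {i} L + invs {v} (insert i U) = Suc (invs {v} U + invs {i} U)"
      unfolding U(1) using invs_insert_right[OF U(2), of "{i}"] invs_insert_right[OF iU(1), of "{v}"] by simp
    have "(-1) ^ invs {i} L * cone v c (insert i L)
        = (-1) ^ (invs {i} L + invs {v} (insert i U)) * c (insert i U)"
      using True by (simp add: cone_def * power_add)
    then show "(-1) ^ invs {i} L * cone v c (insert i L) = - (?s * ?t i)"
      unfolding e by (simp add: power_add)
  qed
  then have 1: "chain_diff a (cone v c) L = - (?s * (\<Sum>i\<in>Poly_Mapping.keys a - L. ?t i))"
    by (simp only: sum_negf sum_distrib_left)
  have "Poly_Mapping.keys a - U = insert v (Poly_Mapping.keys a - L)" using v U by auto
  then have "chain_diff a c U = ?s * c L + (\<Sum>i\<in>Poly_Mapping.keys a - L. ?t i)"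
    using True U by (simp add: chain_diff_def)
  then have "cone v (chain_diff a c) L = c L + ?s * (\<Sum>i\<in>Poly_Mapping.keys a - L. ?t i)"
    using True by (simp add: cone_def flip: U_def) (simp add: distrib_left flip: mult.assoc)
  with 1 show ?thesis by simp
qed

lemma keys_minus_facet_expo:
  "i \<in> Poly_Mapping.keys (a - facet_expo L) \<longleftrightarrow> of_bool (i \<in> L) < Poly_Mapping.lookup a (i :: 'n::finite)"
  by (cases "i \<in> L") (auto simp: in_keys_iff lookup_minus lookup_facet_expo)

lemma keys_single_plus:
  "Poly_Mapping.keys (Poly_Mapping.single w (1 :: nat) + u) = insert w (Poly_Mapping.keys u)"
  by (auto simp: in_keys_iff lookup_add lookup_single when_def split: if_splits)

lemma keys_minus_subset: "Poly_Mapping.keys (a - b :: 'n expo) \<subseteq> Poly_Mapping.keys a"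
  by (auto simp: in_keys_iff lookup_minus)

section \<open>Cycles of a fixed multidegree modulo the edge ideal\<close>

context edge_ideal
begin

definition covers_edge :: "'n expo \<Rightarrow> bool" where "covers_edge u \<longleftrightarrow> (\<exists>e\<in>E. e \<subseteq> Poly_Mapping.keys u)"

lemma single_mem_I_iff: "Poly_Mapping.single u c \<in> I \<longleftrightarrow> c = 0 \<or> covers_edge u"
  by (auto simp: mem_I_iff covers_edge_def)

lemma chain_mem_I_iff:
  "chain a c L \<in> I \<longleftrightarrow> (L \<subseteq> Poly_Mapping.keys a \<longrightarrow> c L = 0 \<or> covers_edge (a - facet_expo L))"
  by (simp add: chain_def single_mem_I_iff zero_I)

lemma cycle_of_I: "(\<And>L. F L \<in> I) \<Longrightarrow> cycle F"
  unfolding cycle_iff_I kdiff_def by (intro allI sum_I mult_I) auto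

text \<open>G differs from F by a boundary and by a chain with all coefficients in I, and both of
  these are cycles.\<close>

lemma cycle_homologous:
  assumes "cycle F" "\<And>L. F L - (kdiff var Y L + G L) \<in> I"
  shows "cycle G"
proof -
  have "G = (\<lambda>L. (F L + - kdiff var Y L) + - (F L - (kdiff var Y L + G L)))" by simp
  moreover have "cycle \<dots>"
    by (intro cycle_add cycle_uminus cycle_kdiff assms(1) cycle_of_I[OF assms(2)])
  ultimately show ?thesis by simp
qed

lemma sign_mult_mem_I_iff: "(-1) ^ k * p \<in> I \<longleftrightarrow> p \<in> I"
  using mult_I[of "(-1) ^ k * p" "(-1) ^ k"] mult_I[of p "(-1) ^ k"] by (auto simp flip: mult.assoc)

lemma edge_other:
  assumes "e \<in> E" "v \<in> e" obtains w where "e = {v, w}" "w \<noteq> v"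
proof -
  from assms simple have "card e = 2" by (auto simp: simple_graph_def)
  with assms(2) that show thesis by (auto simp: card_2_iff doubleton_eq_iff)
qed

text \<open>Since x_w e_M is a cycle, the Leibniz rule leaves x_w times the differential of the
  cofactor, up to sign. No neighbour of w is in the support of a, so the factor x_w cannot complete
  an edge and may be cancelled modulo I.\<close>

lemma cycle_cofactor:
  assumes m: "\<And>i. i \<in> M \<Longrightarrow> {w, i} \<in> E"
    and M: "\<And>i. i \<in> Poly_Mapping.keys a \<Longrightarrow> {w, i} \<in> E \<Longrightarrow> False"
    and disj: "M \<inter> Poly_Mapping.keys a = {}"
    and cyc: "cycle (kwedge (kterm M (var w)) (chain a c))"
  shows "cycle (chain a c)"
  unfolding cycle_iff_I
proof
  let ?m = "kterm M (var w)" and ?z = "chain a c"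
  fix L
  show "kdiff var ?z L \<in> I"
  proof (cases "L \<subseteq> Poly_Mapping.keys a")
    case False
    then show ?thesis by (simp add: kdiff_chain) (simp add: chain_def zero_I)
  next
    case True
    have gi: "grade_inv ?m = kterm M ((-1) ^ card M * var w)"
      by (auto simp: grade_inv_def kterm_def)
    have "kdiff var ?m L \<in> I" for L
      using gen_cycle[OF gen_linear[OF m]] by (simp add: cycle_iff_I)
    then have 1: "kwedge (kdiff var ?m) ?z (M \<union> L) \<in> I"
      unfolding kwedge_def by (subst mult.commute[of "kdiff var _ _"]) (intro sum_I mult_I)
    have "kdiff var (kwedge ?m ?z) (M \<union> L) \<in> I" using cyc by (simp add: cycle_iff_I)
    from add_I[OF this mult_I[OF 1, of "-1"]]
    have "kwedge (grade_inv ?m) (kdiff var ?z) (M \<union> L) \<in> I"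
      by (simp add: kdiff_kwedge)
    \<comment> \<open>The coefficient is read off at \<open>M \<union> L\<close>: removing M
      recovers L because the support of a avoids M.\<close>
    moreover have "M \<union> L - M = L" using disj True by auto
    ultimately have prod: "var w * kdiff var ?z L \<in> I"
      unfolding gi by (simp add: kwedge_term_left sign_mult_mem_I_iff mult.assoc)
    have kd: "kdiff var ?z L = Poly_Mapping.single (a - facet_expo L) (chain_diff a c L)"
      unfolding kdiff_chain using True by (simp add: chain_def)
    have "var w * kdiff var ?z L
        = Poly_Mapping.single (Poly_Mapping.single w 1 + (a - facet_expo L)) (chain_diff a c L)"
      unfolding kd by (simp add: var_def monomial_def mult_single)
    with prod have *: "chain_diff a c L = 0 \<or> covers_edge (Poly_Mapping.single w 1 + (a - facet_expo L))"
      by (simp only: single_mem_I_iff)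
    have "covers_edge (a - facet_expo L)" if cov: "covers_edge (Poly_Mapping.single w 1 + (a - facet_expo L))"
    proof -
      from cov obtain e where e: "e \<in> E" "e \<subseteq> insert w (Poly_Mapping.keys (a - facet_expo L))"
        unfolding covers_edge_def keys_single_plus by blast
      have "w \<notin> e"
      proof
        assume "w \<in> e"
        with e(1) obtain i where i: "e = {w, i}" "i \<noteq> w" by (rule edge_other)
        with e have "i \<in> Poly_Mapping.keys a" using keys_minus_subset[of a "facet_expo L"] by blast
        with M i e show False by blast
      qed
      with e show ?thesis by (auto simp: covers_edge_def)
    qed
    with * show ?thesis by (auto simp: kdiff_chain chain_mem_I_iff)
  qed
qed

lemma chain_gen:
  assumes leaf: "\<And>W :: 'n set. W \<noteq> {} \<Longrightarrow>
      \<exists>v\<in>W. \<forall>w\<in>W. \<forall>w'\<in>W. {v, w} \<in> E \<longrightarrow> {v, w'} \<in> E \<longrightarrow> w = w'"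
    and "cycle (chain a c)"
  shows "chain a c \<in> gen"
  using assms(2)
proof (induction "expo_degree a" arbitrary: a c rule: less_induct)
  case less
  note cyc = \<open>cycle (chain a c)\<close>
  show ?case
  proof (cases "Poly_Mapping.keys a = {}")
    case True
    then have "chain a c = kterm {} (const (c {}))"
      by (auto simp: chain_def kterm_def const_def facet_expo_def)
    then show ?thesis using gen_scalar by simp
  next
    case False
    from leaf[OF False] obtain v where v: "v \<in> Poly_Mapping.keys a"
      and v_leaf: "\<And>w w'. w \<in> Poly_Mapping.keys a \<Longrightarrow> w' \<in> Poly_Mapping.keys a \<Longrightarrow>
        {v, w} \<in> E \<Longrightarrow> {v, w'} \<in> E \<Longrightarrow> w = w'"
      by blast
    \<comment> \<open>The homotopy writes c as d(cone c) + cone(dc). The second part is kept, with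
      coefficient 0 wherever the monomial lies in I, so every surviving term has its monomial
      outside I.\<close>
    define c1 where "c1 = (\<lambda>L. if covers_edge (a - facet_expo L) then 0 else cone v (chain_diff a c) L)"
    have hom: "chain a c L - (kdiff var (chain a (cone v c)) L + chain a c1 L) \<in> I" for L
      unfolding kdiff_chain chain_plus chain_minus chain_mem_I_iff
      using chain_diff_cone[OF v, of c L] by (auto simp: c1_def algebra_simps)
    have cyc1: "cycle (chain a c1)" by (rule cycle_homologous[OF cyc hom])
    have nbr: "v \<in> L \<and> (\<exists>w\<in>Poly_Mapping.keys (a - facet_expo L). {v, w} \<in> E)"
      if "L \<subseteq> Poly_Mapping.keys a" "c1 L \<noteq> 0" for L
    proof -
      from that have L: "\<not> covers_edge (a - facet_expo L)" "v \<in> L" "chain_diff a c (L - {v}) \<noteq> 0"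
        by (auto simp: c1_def cone_def split: if_splits)
      \<comment> \<open>The cycle condition at L - {v}: a nonzero coefficient of dc there puts the
        monomial x_v x^(a - L) into I.\<close>
      from cyc have "chain a (chain_diff a c) (L - {v}) \<in> I" by (simp add: cycle_iff_I kdiff_chain)
      with L(3) that(1) have "covers_edge (a - facet_expo (L - {v}))" by (auto simp: chain_mem_I_iff)
      then obtain e where e: "e \<in> E" "e \<subseteq> Poly_Mapping.keys (a - facet_expo (L - {v}))"
        by (auto simp: covers_edge_def)
      \<comment> \<open>Only v can be new in the support, so an edge that was not covered before
        must pass through v.\<close>
      have sub: "Poly_Mapping.keys (a - facet_expo (L - {v}))
          \<subseteq> insert v (Poly_Mapping.keys (a - facet_expo L))"
        by (auto simp: keys_minus_facet_expo of_bool_def split: if_splits)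
      with e L(1) have "v \<in> e" unfolding covers_edge_def by blast
      with e(1) obtain w where "e = {v, w}" "w \<noteq> v" by (rule edge_other)
      with e sub L(2) show ?thesis by blast
    qed
    have "chain a c1 \<in> gen"
    proof (cases "\<exists>L\<subseteq>Poly_Mapping.keys a. c1 L \<noteq> 0")
      case False
      then have "chain a c1 = kterm {} (const 0)"
        by (auto simp: chain_def kterm_def const_def)
      then show ?thesis using gen_scalar by simp
    next
      case True
      then obtain L0 where L0: "L0 \<subseteq> Poly_Mapping.keys a" "c1 L0 \<noteq> 0" by blast
      \<comment> \<open>The neighbour w is read off one nonzero term; by the choice of v the same w
        serves for all of them.\<close>
      with nbr[OF L0] obtain w where w: "w \<in> Poly_Mapping.keys (a - facet_expo L0)" "{v, w} \<in> E" by blast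
      have keys: "w' \<in> Poly_Mapping.keys a" if "w' \<in> Poly_Mapping.keys (a - facet_expo L)" for w' L
        by (rule subsetD[OF keys_minus_subset that])
      have w_key: "w \<in> Poly_Mapping.keys (a - facet_expo L)"
        if "L \<subseteq> Poly_Mapping.keys a" "c1 L \<noteq> 0" for L
      proof -
        from nbr[OF that] obtain w' where w': "w' \<in> Poly_Mapping.keys (a - facet_expo L)" "{v, w'} \<in> E"
          by blast
        have "w' = w" by (rule v_leaf[OF keys[OF w'(1)] keys[OF w(1)] w'(2) w(2)])
        with w'(1) show ?thesis by simp
      qed
      define M where "M = {i \<in> Poly_Mapping.keys a. {w, i} \<in> E}"
      have wM: "w \<notin> M" using simple by (auto simp: M_def simple_graph_def)
      have M_sub: "M \<subseteq> L" and M_lookup: "\<And>i. i \<in> M \<Longrightarrow> Poly_Mapping.lookup a i = 1"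
        if L: "L \<subseteq> Poly_Mapping.keys a" "c1 L \<noteq> 0" for L
      proof -
        \<comment> \<open>Otherwise i and w would both remain in the support of a - L and cover the
          edge {w, i}. Hence i, being in the support of a, has exponent exactly 1, used up by
          e_L.\<close>
        have *: "\<not> of_bool (i \<in> L) < Poly_Mapping.lookup a i" if "i \<in> M" for i
        proof
          assume "of_bool (i \<in> L) < Poly_Mapping.lookup a i"
          with w_key[OF L] have "{w, i} \<subseteq> Poly_Mapping.keys (a - facet_expo L)"
            by (simp add: keys_minus_facet_expo)
          with that have "covers_edge (a - facet_expo L)" unfolding covers_edge_def M_def by blast
          with L(2) show False by (simp add: c1_def)
        qed
        have "i \<in> L \<and> Poly_Mapping.lookup a i = 1" if "i \<in> M" for i
          using *[OF that] that by (cases "i \<in> L") (auto simp: M_def in_keys_iff)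
        then show "M \<subseteq> L" "\<And>i. i \<in> M \<Longrightarrow> Poly_Mapping.lookup a i = 1" by auto
      qed
      \<comment> \<open>The multidegree of x_w e_M is split off. The factor x_w alone makes the
        total degree drop.\<close>
      define a' where "a' = a - (facet_expo M + Poly_Mapping.single w 1)"
      have lookup_a': "Poly_Mapping.lookup a' i =
        (if i = w then Poly_Mapping.lookup a w - 1 else if i \<in> M then 0 else Poly_Mapping.lookup a i)" for i
        using M_lookup[OF L0] wM
        by (auto simp: a'_def lookup_minus lookup_add lookup_single lookup_facet_expo when_def)
      have w_pos: "0 < Poly_Mapping.lookup a w"
        using keys[OF w(1)] by (simp add: in_keys_iff)
      have "a = a' + (facet_expo M + Poly_Mapping.single w 1)"
        using M_lookup[OF L0] wM w_pos
        by (intro poly_mapping_eqI)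
          (auto simp: lookup_a' lookup_add lookup_single lookup_facet_expo when_def)
      then have deg: "expo_degree a' < expo_degree a"
        by (metis add.assoc expo_degree_add expo_degree_single less_add_Suc1 add_Suc_right add_0_right One_nat_def)
      have keys_a': "Poly_Mapping.keys a' \<subseteq> Poly_Mapping.keys a" "M \<inter> Poly_Mapping.keys a' = {}"
        using wM by (auto simp: lookup_a' in_keys_iff split: if_splits)
      \<comment> \<open>The sign compensates the one produced when e_M is multiplied by e_L.\<close>
      define c2 where "c2 = (\<lambda>L. (-1) ^ invs M L * c1 (M \<union> L))"
      have eq: "kwedge (kterm M (var w)) (chain a' c2) = chain a c1"
      proof
        fix L
        show "kwedge (kterm M (var w)) (chain a' c2) L = chain a c1 L"
        proof (cases "L \<subseteq> Poly_Mapping.keys a \<and> c1 L \<noteq> 0")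
          case True
          note L = conjunct1[OF True] conjunct2[OF True]
          have M: "M \<subseteq> L" by (rule M_sub[OF L])
          \<comment> \<open>If w is in L, its exponent in a is at least 2, so w survives in the
            support of a' after one x_w has been removed.\<close>
          have wL: "of_bool (w \<in> L) < Poly_Mapping.lookup a w"
            using w_key[OF L] by (simp add: keys_minus_facet_expo)
          have 1: "L - M \<subseteq> Poly_Mapping.keys a'"
          proof
            fix i assume i: "i \<in> L - M"
            with L(1) have "i \<in> Poly_Mapping.keys a" by blast
            with i wL show "i \<in> Poly_Mapping.keys a'" by (auto simp: in_keys_iff lookup_a')
          qed
          have 2: "Poly_Mapping.single w 1 + (a' - facet_expo (L - M)) = a - facet_expo L"
            using wL wM M M_lookup[OF L0]
            by (intro poly_mapping_eqI)
              (auto simp: lookup_a' lookup_add lookup_minus lookup_single lookup_facet_expo when_def)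
          have 3: "M \<union> (L - M) = L" using M by auto
          show ?thesis
            using L 1 2 3 M
            by (simp add: kwedge_term_left chain_def c2_def var_def monomial_def mult_single
                sign_mult_single flip: mult.assoc)
        next
          case False
          then have "chain a c1 L = 0" by (auto simp: chain_def)
          moreover have "chain a' c2 (L - M) = 0" if "M \<subseteq> L"
          proof (cases "L - M \<subseteq> Poly_Mapping.keys a'")
            case True
            with keys_a' have "L \<subseteq> Poly_Mapping.keys a" by (auto simp: M_def)
            with False have "c1 (M \<union> (L - M)) = 0" using that by (simp add: Un_absorb1)
            then show ?thesis by (simp add: chain_def c2_def)
          qed (simp add: chain_def)
          ultimately show ?thesis by (simp add: kwedge_term_left)
        qed
      qed
      have M_edges: "{w, i} \<in> E" if "i \<in> M" for i using that by (simp add: M_def)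
      have M_nbr: False if "i \<in> Poly_Mapping.keys a'" "{w, i} \<in> E" for i
        using that keys_a' by (auto simp: M_def)
      have cyc': "cycle (kwedge (kterm M (var w)) (chain a' c2))" unfolding eq by (rule cyc1)
      have "cycle (chain a' c2)"
        by (rule cycle_cofactor[OF M_edges M_nbr keys_a'(2) cyc'])
      then have "chain a' c2 \<in> gen" by (rule less.hyps[OF deg])
      then have "kwedge (kterm M (var w)) (chain a' c2) \<in> gen"
        by (intro gen_kwedge gen_linear M_edges)
      then show ?thesis unfolding eq .
    qed
    then show ?thesis by (rule gen_homologous[OF cyc _ hom])
  qed
qed

lemma gen_sum: "finite S \<Longrightarrow> (\<And>s. s \<in> S \<Longrightarrow> F s \<in> gen) \<Longrightarrow> (\<lambda>L. \<Sum>s\<in>S. F s L) \<in> gen"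
proof (induction S rule: finite_induct)
  case empty
  have "kterm {} (const 0) = (\<lambda>L :: 'n set. 0 :: ('n, 'k) mpoly)" by (auto simp: kterm_def const_def)
  then show ?case using gen_scalar[of 0] by simp
next
  case (insert s S)
  then show ?case using gen_add[of "F s" "\<lambda>L. \<Sum>s\<in>S. F s L"] by simp
qed

end

section \<open>Decomposition into multigraded components\<close>

lemma lookup_chain:
  "Poly_Mapping.lookup (chain a c L) u = (if a = u + facet_expo L then c L else 0)"
proof -
  have "L \<subseteq> Poly_Mapping.keys a \<and> a - facet_expo L = u \<longleftrightarrow> a = u + facet_expo L"
  proof
    assume *: "L \<subseteq> Poly_Mapping.keys a \<and> a - facet_expo L = u"
    then obtain v where "a = v + facet_expo L" using facet_expo_le_iff by blast
    with * show "a = u + facet_expo L" by simp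
  next
    assume "a = u + facet_expo L"
    then show "L \<subseteq> Poly_Mapping.keys a \<and> a - facet_expo L = u" using facet_expo_le_iff by auto
  qed
  then show ?thesis by (auto simp: chain_def lookup_single when_def)
qed

text \<open>The term x^u e_L has multidegree u + L; the finitely many multidegrees that occur index
  the components.\<close>

lemma chain_decomposition:
  fixes F :: "'n::finite set \<Rightarrow> ('n, 'k::field) mpoly"
  obtains S c where "finite S" "F = (\<lambda>L. \<Sum>a\<in>S. chain a (c a) L)"
proof
  let ?S = "\<Union>L. (\<lambda>u. u + facet_expo L) ` Poly_Mapping.keys (F L)"
  show "finite ?S" by simp
  show "F = (\<lambda>L. \<Sum>a\<in>?S. chain a (\<lambda>L. Poly_Mapping.lookup (F L) (a - facet_expo L)) L)"
  proof (rule ext, rule poly_mapping_eqI)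
    fix L u
    have "Poly_Mapping.lookup (\<Sum>a\<in>?S. chain a (\<lambda>L. Poly_Mapping.lookup (F L) (a - facet_expo L)) L) u
      = (\<Sum>a\<in>?S. if a = u + facet_expo L then Poly_Mapping.lookup (F L) u else 0)"
      unfolding lookup_sum by (intro sum.cong) (auto simp: lookup_chain)
    also have "\<dots> = Poly_Mapping.lookup (F L) u"
    proof (cases "Poly_Mapping.lookup (F L) u = 0")
      case False
      then have "u + facet_expo L \<in> ?S" by (intro UN_I[of L] imageI) (auto simp: in_keys_iff)
      then show ?thesis by (simp del: UN_iff)
    qed simp
    finally show "Poly_Mapping.lookup (F L) u = Poly_Mapping.lookup
      (\<Sum>a\<in>?S. chain a (\<lambda>L. Poly_Mapping.lookup (F L) (a - facet_expo L)) L) u" ..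
  qed
qed

lemma kdiff_sum: "kdiff x (\<lambda>L. \<Sum>s\<in>S. F s L) = (\<lambda>L. \<Sum>s\<in>S. kdiff x (F s) L)"
  unfolding kdiff_def by (rule ext) (simp add: sum_distrib_left sum.swap[of _ _ S])

text \<open>The differential preserves multidegree and I is a monomial ideal, so membership in I can
  be tested on one exponent u at a time; together with L it singles out the component of multidegree
  u + L.\<close>

lemma (in edge_ideal) cycle_chain_component:
  assumes "finite S" "cycle (\<lambda>L. \<Sum>a\<in>S. chain a (c a) L)" "a \<in> S"
  shows "cycle (chain a (c a))"
  unfolding cycle_iff_I kdiff_chain chain_mem_I_iff
proof (intro allI impI)
  fix L assume L: "L \<subseteq> Poly_Mapping.keys a"
  let ?p = "\<Sum>a\<in>S. chain a (chain_diff a (c a)) L"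
  have "?p \<in> I" using assms(2) by (simp add: cycle_iff_I kdiff_sum kdiff_chain)
  obtain u where u: "a = u + facet_expo L" using L facet_expo_le_iff by blast
  have "Poly_Mapping.lookup ?p u = (\<Sum>b\<in>S. if b = a then chain_diff a (c a) L else 0)"
    unfolding lookup_sum by (intro sum.cong) (auto simp: lookup_chain u)
  with assms(1,3) have "Poly_Mapping.lookup ?p u = chain_diff a (c a) L" by simp
  moreover have "Poly_Mapping.lookup ?p u = 0 \<or> covers_edge u"
  proof (cases "u \<in> Poly_Mapping.keys ?p")
    case True
    with \<open>?p \<in> I\<close> show ?thesis unfolding mem_I_iff covers_edge_def by blast
  qed (simp add: in_keys_iff)
  ultimately show "chain_diff a (c a) L = 0 \<or> covers_edge (a - facet_expo L)" by (simp add: u)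
qed

subsection \<open>Forests\<close>

text \<open>In a longest path inside W, two distinct neighbours of the first vertex would both lie
  on the path, and the farther one would close a cycle.\<close>

lemma ex_leaf:
  fixes E :: "'v::finite set set"
  assumes simple: "simple_graph E" and acyclic: "\<nexists>vs. graph_cycle E vs" and W: "W \<noteq> {}"
  shows "\<exists>v\<in>W. \<forall>w\<in>W. \<forall>w'\<in>W. {v, w} \<in> E \<longrightarrow> {v, w'} \<in> E \<longrightarrow> w = w'"
proof (rule ccontr)
  assume no_leaf: "\<not> ?thesis"
  define path where "path vs \<longleftrightarrow> vs \<noteq> [] \<and> distinct vs \<and> set vs \<subseteq> W \<and>
    (\<forall>k. Suc k < length vs \<longrightarrow> {vs ! k, vs ! Suc k} \<in> E)" for vs
  obtain v0 where "v0 \<in> W" using W by blast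
  then have "path [v0]" by (simp add: path_def)
  moreover have "length vs < Suc (card (UNIV :: 'v set))" if "path vs" for vs
    using that card_mono[of UNIV "set vs"] by (simp add: path_def distinct_card less_Suc_eq_le)
  ultimately obtain vs where vs: "path vs" and longest: "\<And>us. path us \<Longrightarrow> length us \<le> length vs"
    using ex_has_greatest_nat[of path "[v0]" length "Suc (card (UNIV :: 'v set))"] by blast
  have nbr: "\<exists>k. 0 < k \<and> k < length vs \<and> x = vs ! k" if x: "x \<in> W" "{vs ! 0, x} \<in> E" for x
  proof -
    have "x \<in> set vs"
    proof (rule ccontr)
      assume "x \<notin> set vs"
      have "{(x # vs) ! k, (x # vs) ! Suc k} \<in> E" if "Suc k < length (x # vs)" for k
        using that vs x(2) by (cases k) (auto simp: path_def insert_commute)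
      with \<open>x \<notin> set vs\<close> vs x(1) have "path (x # vs)" by (simp add: path_def)
      with longest show False by fastforce
    qed
    then obtain k where k: "k < length vs" "x = vs ! k" by (auto simp: in_set_conv_nth)
    moreover have "k \<noteq> 0"
    proof
      assume "k = 0"
      with x(2) k(2) have "{vs ! 0} \<in> E" by simp
      with simple show False by (fastforce simp: simple_graph_def)
    qed
    ultimately show ?thesis by auto
  qed
  \<comment> \<open>The neighbours in \<open>W\<close> of the first vertex of a longest path lie on the path.\<close>
  have "vs ! 0 \<in> W" using vs by (auto simp: path_def)
  then obtain w w' where w: "w \<in> W" "{vs ! 0, w} \<in> E" "w' \<in> W" "{vs ! 0, w'} \<in> E" "w \<noteq> w'"
    using no_leaf by blast
  from nbr[OF w(1,2)] nbr[OF w(3,4)] obtain k k' where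
    k: "0 < k" "k < length vs" "w = vs ! k" and k': "0 < k'" "k' < length vs" "w' = vs ! k'" by blast
  have "k \<noteq> k'" using k k' w(5) by auto
  \<comment> \<open>At most one of the two neighbours has index 1; the other has index at least 2,
    which gives the cycle at least three vertices.\<close>
  then have "\<exists>m\<ge>2. m < length vs \<and> {vs ! 0, vs ! m} \<in> E"
    using k k' w(2,4) by (cases "k = 1") (auto intro: exI[of _ k] exI[of _ k'])
  then obtain m where m: "2 \<le> m" "m < length vs" "{vs ! 0, vs ! m} \<in> E" by blast
  have "{take (Suc m) vs ! j, take (Suc m) vs ! (Suc j mod Suc m)} \<in> E" if "j < Suc m" for j
  proof (cases "j = m")
    case True
    with m show ?thesis by (simp add: insert_commute)
  next
    case False
    with that have "j < m" by simp
    with m vs show ?thesis by (auto simp: path_def)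
  qed
  with m vs have "graph_cycle E (take (Suc m) vs)"
    by (auto simp: graph_cycle_def path_def)
  with acyclic show False by blast
qed

subsection \<open>Generation by linear monomial cycles\<close>

theorem proposition2p12:
  fixes E :: "'n::{finite,linorder} set set"
    and I :: "('n, 'k::field) mpoly set"
  assumes forest: "edge_forest E"
    and I: "I = facet_ideal E"
  shows "generated_subalgebra I (quot_class I ` linear_monomial_cycles (facet_generators E))
           = carrier (quot_homology I)"
proof -
  from forest have simple: "simple_graph E" and acyclic: "\<nexists>vs. graph_cycle E vs" and "E \<noteq> {}"
    by (auto simp: edge_forest_def)
  interpret edge_ideal E I
    by (rule edge_ideal.intro) fact+
  let ?L = "linear_monomial_cycles (facet_generators E)"
  have "quot_class I z \<in> carrier H" if "z \<in> ?L" for z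
  proof -
    from that have "z \<in> koszul_cycles (poly_ring Quot I) (residue_var I)"
      unfolding linear_monomial_cycles_def is_monomial_cycle_def
        I[unfolded facet_ideal_def, symmetric] by blast
    then have "z \<in> carrier Z" by (simp add: koszul_cycle_ring_def)
    then obtain F where "z = lift F" "cycle F" unfolding carrier_Z by blast
    then show ?thesis by (simp add: quot_class_lift cls_in_H)
  qed
  then have "quot_class I ` ?L \<subseteq> carrier H" by blast
  moreover have "scalar_classes I \<subseteq> carrier H"
  proof
    fix y assume "y \<in> scalar_classes I"
    then obtain c where "y = quot_class I (koszul_term (poly_ring Quot I) (residue I (const c)) {})"
      unfolding scalar_classes_def by blast
    then show "y \<in> carrier H"
      by (simp add: koszul_term_lift quot_class_lift cls_in_H cycle_scalar)
  qed
  \<comment> \<open>The easy inclusion: the generators are classes of cycles, and the homology ring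
    is closed under its operations.\<close>
  ultimately have gens: "scalar_classes I \<union> quot_class I ` ?L \<subseteq> carrier H" by (rule Un_least[rotated])
  have "generated_subalgebra I (quot_class I ` ?L) \<subseteq> carrier H"
    unfolding generated_subalgebra_def quot_homology_eq
    by (rule subsetI, rule ring.generate_ring_in_carrier[OF ring_H gens])
  moreover have "carrier H \<subseteq> generated_subalgebra I (quot_class I ` ?L)"
  proof
    fix y assume "y \<in> carrier H"
    then obtain F where y: "y = cls F" "cycle F" by (auto simp: carrier_H)
    obtain S c where S: "finite S" and F: "F = (\<lambda>L. \<Sum>a\<in>S. chain a (c a) L)"
      by (rule chain_decomposition)
    \<comment> \<open>Each component of the cycle is a cycle, and acyclicity supplies the leaves for
      the induction on degree.\<close>
    have "chain a (c a) \<in> gen" if "a \<in> S" for a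
      using ex_leaf[OF simple acyclic] cycle_chain_component[OF S y(2)[unfolded F] that]
      by (rule chain_gen)
    then have "F \<in> gen" unfolding F by (rule gen_sum[OF S])
    with y(1) show "y \<in> generated_subalgebra I (quot_class I ` ?L)" by (simp add: gen_def)
  qed
  ultimately show ?thesis unfolding quot_homology_eq by blast
qed

end
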